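(* Let $\mu$ be a finite positive Borel measure on the interval $[0,1)$. If $\alpha>1$ and $0<\beta<\alpha+1$, then $\mathcal{C}_\mu:\mathcal{B}^{\alpha}\to\mathcal{B}^{\beta}$ is compact if and only if $\mu$ is a vanishing $(\alpha+1-\beta)$-Carleson measure.
   Context: Let $\mathbb{D}=\{z\in\mathbb{C}:|z|<1\}$ and let $H(\mathbb{D})$ be the space of all analytic functions in $\mathbb{D}$. For $0<\alpha<\infty$, the Bloch-type space is $\mathcal{B}^{\alpha}=\{f\in H(\mathbb{D}):\|f\|_{\mathcal{B}^\alpha}=|f(0)|+\sup_{z\in\mathbb{D}}(1-|z|^2)^{\alpha}|f'(z)|<\infty\}$. For a finite positive Borel measure $\mu$ on $[0,1)$ and $f(z)=\sum_{n=0}^\infty a_nz^n\in H(\mathbb{D})$, the Cesàro-like operator is $$\mathcal{C}_\mu(f)(z)=\sum_{n=0}^\infty\left(\mu_n\sum_{k=0}^n a_k\right)z^n=\int_{[0,1)}\frac{f(tz)}{1-tz}\,d\mu(t),\quad z\in\mathbb{D},$$ where $\mu_n=\int_{[0,1)}t^n\,d\mu(t)$. For $0<s<\infty$, a positive Borel measure $\nu$ on $\mathbb{D}$ is a vanishing $s$-Carleson measure if $\lim_{|I|\to 0}\nu(S(I))/|I|^s=0$, where $I\subset\partial\mathbb{D}$ ranges over arcs, $|I|$ is the length of $I$, and $S(I)=\{re^{i\vartheta}:e^{i\vartheta}\in I,\ 1-\frac{|I|}{2\pi}\le r<1\}$. A measure $\mu$ on $[0,1)$ is regarded as a measure on $\mathbb{D}$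 via $\overline{\mu}(E)=\mu(E\cap[0,1))$; thus $\mu$ is a vanishing $s$-Carleson measure if and only if $\lim_{t\to1^-}\mu([t,1))/(1-t)^s=0$. *)

theory Defs
  imports "HOL-Complex_Analysis.Complex_Analysis"
begin

section \<open>Bloch-type spaces\<close>

text \<open>A function on the open unit disc is represented by a total function that vanishes outside
  the disc. With this normalisation the Bloch norm separates points.\<close>

definition hol_disc :: "(complex \<Rightarrow> complex) set" where
  "hol_disc = {f. f holomorphic_on ball 0 1 \<and> (\<forall>z. z \<notin> ball 0 1 \<longrightarrow> f z = 0)}"

definition bloch_weight :: "real \<Rightarrow> (complex \<Rightarrow> complex) \<Rightarrow> complex \<Rightarrow> real" where
  "bloch_weight \<alpha> f z = (1 - (cmod z)\<^sup>2) powr \<alpha> * cmod (deriv f z)"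

definition Bloch :: "real \<Rightarrow> (complex \<Rightarrow> complex) set" where
  "Bloch \<alpha> = {f \<in> hol_disc. bdd_above (bloch_weight \<alpha> f ` ball 0 1)}"

definition bloch_norm :: "real \<Rightarrow> (complex \<Rightarrow> complex) \<Rightarrow> real" where
  "bloch_norm \<alpha> f = cmod (f 0) + (SUP z\<in>ball 0 1. bloch_weight \<alpha> f z)"

text \<open>The value off the carrier is arbitrary: the locale \<^locale>\<open>Metric_space\<close> asks for symmetry
  and nonnegativity on the whole type.\<close>

definition bloch_dist :: "real \<Rightarrow> (complex \<Rightarrow> complex) \<Rightarrow> (complex \<Rightarrow> complex) \<Rightarrow> real" where
  "bloch_dist \<alpha> f g =
     (if f \<in> Bloch \<alpha> \<and> g \<in> Bloch \<alpha> then bloch_norm \<alpha> (\<lambda>z. f z - g z) else 0)"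

lemma hol_disc_diff: "f \<in> hol_disc \<Longrightarrow> g \<in> hol_disc \<Longrightarrow> (\<lambda>z. f z - g z) \<in> hol_disc"
  by (auto simp: hol_disc_def intro!: holomorphic_intros)

lemma hol_disc_differentiable:
  "f \<in> hol_disc \<Longrightarrow> z \<in> ball 0 1 \<Longrightarrow> f field_differentiable at z"
  by (metis (mono_tags, lifting) hol_disc_def holomorphic_on_imp_differentiable_at mem_Collect_eq open_ball)

lemma bloch_weight_diff_le:
  assumes "f \<in> hol_disc" "g \<in> hol_disc" "z \<in> ball 0 1"
  shows "bloch_weight \<alpha> (\<lambda>z. f z - g z) z \<le> bloch_weight \<alpha> f z + bloch_weight \<alpha> g z"
proof -
  have "deriv (\<lambda>z. f z - g z) z = deriv f z - deriv g z"
    using assms hol_disc_differentiable by (intro deriv_diff) auto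
  then show ?thesis
    unfolding bloch_weight_def
    by (metis distrib_left mult_left_mono norm_triangle_ineq4 powr_ge_zero)
qed

lemma Bloch_diff:
  assumes "f \<in> Bloch \<alpha>" "g \<in> Bloch \<alpha>"
  shows "(\<lambda>z. f z - g z) \<in> Bloch \<alpha>"
proof -
  obtain A B where "\<And>z. z \<in> ball 0 1 \<Longrightarrow> bloch_weight \<alpha> f z \<le> A"
    and "\<And>z. z \<in> ball 0 1 \<Longrightarrow> bloch_weight \<alpha> g z \<le> B"
    using assms unfolding Bloch_def bdd_above_def by blast
  then have "bdd_above (bloch_weight \<alpha> (\<lambda>z. f z - g z) ` ball 0 1)"
    using assms bloch_weight_diff_le[of f g _ \<alpha>]
    by (intro bdd_aboveI[of _ "A + B"]) (fastforce simp: Bloch_def)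
  then show ?thesis
    using assms hol_disc_diff by (auto simp: Bloch_def)
qed

lemma bloch_weight_le_SUP:
  "f \<in> Bloch \<alpha> \<Longrightarrow> z \<in> ball 0 1 \<Longrightarrow> bloch_weight \<alpha> f z \<le> (SUP z\<in>ball 0 1. bloch_weight \<alpha> f z)"
  by (auto simp: Bloch_def intro!: cSUP_upper)

lemma SUP_bloch_weight_nonneg:
  assumes "f \<in> Bloch \<alpha>"
  shows "0 \<le> (SUP z\<in>ball 0 1. bloch_weight \<alpha> f z)"
  using bloch_weight_le_SUP[OF assms, of 0]
  by (smt (verit) bloch_weight_def centre_in_ball mult_nonneg_nonneg norm_ge_zero powr_ge_zero)

lemma bloch_norm_eq_0:
  assumes f: "f \<in> Bloch \<alpha>" and 0: "bloch_norm \<alpha> f = 0"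
  shows "f z = 0"
proof (cases "z \<in> ball 0 1")
  case True
  have S: "(SUP z\<in>ball 0 1. bloch_weight \<alpha> f z) = 0" and f0: "f 0 = 0"
    using 0 SUP_bloch_weight_nonneg[OF f] norm_ge_zero[of "f 0"]
    unfolding bloch_norm_def by (linarith, smt (verit) norm_le_zero_iff)
  have d: "(f has_field_derivative 0) (at w within ball 0 1)" if w: "w \<in> ball 0 1" for w
  proof -
    have "(cmod w)\<^sup>2 < 1"
      using w by (simp add: abs_square_less_1)
    moreover have "bloch_weight \<alpha> f w \<le> 0"
      using bloch_weight_le_SUP[OF f w] S by simp
    ultimately have "deriv f w = 0"
      unfolding bloch_weight_def by (simp add: mult_le_0_iff)
    then show ?thesis
      using hol_disc_differentiable[OF _ w] f w
      by (metis (no_types, lifting) Bloch_def DERIV_deriv_iff_field_differentiable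
          has_field_derivative_at_within mem_Collect_eq)
  qed
  obtain c where "\<And>w. w \<in> ball 0 1 \<Longrightarrow> f w = c"
    using has_field_derivative_zero_constant[OF convex_ball d] by blast
  then show ?thesis
    using True f0 by (metis centre_in_ball zero_less_one)
next
  case False
  then show ?thesis
    using f by (simp add: Bloch_def hol_disc_def)
qed

lemma bloch_norm_diff_le:
  assumes "f \<in> Bloch \<alpha>" "g \<in> Bloch \<alpha>"
  shows "bloch_norm \<alpha> (\<lambda>z. f z - g z) \<le> bloch_norm \<alpha> f + bloch_norm \<alpha> g"
proof -
  have "(SUP z\<in>ball 0 1. bloch_weight \<alpha> (\<lambda>z. f z - g z) z)
      \<le> (SUP z\<in>ball 0 1. bloch_weight \<alpha> f z) + (SUP z\<in>ball 0 1. bloch_weight \<alpha> g z)"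
  proof (rule cSUP_least)
    fix z :: complex assume z: "z \<in> ball 0 1"
    have "bloch_weight \<alpha> (\<lambda>z. f z - g z) z \<le> bloch_weight \<alpha> f z + bloch_weight \<alpha> g z"
      using assms z by (intro bloch_weight_diff_le) (auto simp: Bloch_def)
    then show "bloch_weight \<alpha> (\<lambda>z. f z - g z) z
      \<le> (SUP z\<in>ball 0 1. bloch_weight \<alpha> f z) + (SUP z\<in>ball 0 1. bloch_weight \<alpha> g z)"
      using bloch_weight_le_SUP[OF assms(1) z] bloch_weight_le_SUP[OF assms(2) z] by linarith
  qed auto
  then show ?thesis
    unfolding bloch_norm_def using norm_triangle_ineq4[of "f 0" "g 0"] by linarith
qed

lemma bloch_norm_minus_commute:
  assumes "f \<in> Bloch \<alpha>" "g \<in> Bloch \<alpha>"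
  shows "bloch_norm \<alpha> (\<lambda>z. f z - g z) = bloch_norm \<alpha> (\<lambda>z. g z - f z)"
proof -
  have "bloch_weight \<alpha> (\<lambda>z. f z - g z) z = bloch_weight \<alpha> (\<lambda>z. g z - f z) z"
    if z: "z \<in> ball 0 1" for z
  proof -
    have "f field_differentiable at z" "g field_differentiable at z"
      using assms z hol_disc_differentiable by (auto simp: Bloch_def)
    then show ?thesis
      by (simp add: bloch_weight_def norm_minus_commute)
  qed
  then have "(SUP z\<in>ball 0 1. bloch_weight \<alpha> (\<lambda>z. f z - g z) z) =
      (SUP z\<in>ball 0 1. bloch_weight \<alpha> (\<lambda>z. g z - f z) z)"
    by (intro SUP_cong refl)
  then show ?thesis
    unfolding bloch_norm_def by (simp add: norm_minus_commute)
qed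

lemma Metric_space_Bloch: "Metric_space (Bloch \<alpha>) (bloch_dist \<alpha>)"
proof
  fix f g h
  have nonneg: "0 \<le> bloch_norm \<alpha> f" if "f \<in> Bloch \<alpha>" for f
    using SUP_bloch_weight_nonneg[OF that] by (simp add: bloch_norm_def)
  have zero: "bloch_norm \<alpha> (\<lambda>z. 0) = 0"
    by (simp add: bloch_norm_def bloch_weight_def)
  show "0 \<le> bloch_dist \<alpha> f g"
    using nonneg Bloch_diff by (simp add: bloch_dist_def)
  show "bloch_dist \<alpha> f g = bloch_dist \<alpha> g f"
    using bloch_norm_minus_commute[of f \<alpha> g] by (auto simp: bloch_dist_def)
  show "bloch_dist \<alpha> f g = 0 \<longleftrightarrow> f = g" if fg: "f \<in> Bloch \<alpha>" "g \<in> Bloch \<alpha>"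
  proof
    assume "bloch_dist \<alpha> f g = 0"
    then have "f z - g z = 0" for z
      using bloch_norm_eq_0[OF Bloch_diff[OF fg]] fg by (simp add: bloch_dist_def)
    then show "f = g" by (simp add: fun_eq_iff)
  qed (simp add: bloch_dist_def zero)
  show "bloch_dist \<alpha> f h \<le> bloch_dist \<alpha> f g + bloch_dist \<alpha> g h"
    if fgh: "f \<in> Bloch \<alpha>" "g \<in> Bloch \<alpha>" "h \<in> Bloch \<alpha>"
    using bloch_norm_diff_le[OF Bloch_diff[OF fgh(1,2)] Bloch_diff[OF fgh(3,2)]]
      bloch_norm_minus_commute[OF fgh(2,3)] fgh by (simp add: bloch_dist_def)
qed

definition Bloch_topology :: "real \<Rightarrow> (complex \<Rightarrow> complex) topology" where
  "Bloch_topology \<alpha> = Metric_space.mtopology (Bloch \<alpha>) (bloch_dist \<alpha>)"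

lemma topspace_Bloch_topology [simp]: "topspace (Bloch_topology \<alpha>) = Bloch \<alpha>"
  by (simp add: Bloch_topology_def Metric_space.topspace_mtopology[OF Metric_space_Bloch])

text \<open>Compactness of \<open>T\<close> as an operator from \<open>Bloch \<alpha>\<close> to \<open>Bloch \<beta>\<close>:
  bounded sets have relatively compact images. This is meant for linear \<open>T\<close>; linearity is
  not part of the predicate.\<close>

definition compact_Bloch_operator ::
  "real \<Rightarrow> real \<Rightarrow> ((complex \<Rightarrow> complex) \<Rightarrow> (complex \<Rightarrow> complex)) \<Rightarrow> bool" where
  "compact_Bloch_operator \<alpha> \<beta> T \<longleftrightarrow>
     T ` Bloch \<alpha> \<subseteq> Bloch \<beta> \<and>
     (\<forall>S B. S \<subseteq> Bloch \<alpha> \<and> (\<forall>f\<in>S. bloch_norm \<alpha> f \<le> B) \<longrightarrow>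
        compactin (Bloch_topology \<beta>) (Bloch_topology \<beta> closure_of (T ` S)))"


section \<open>The Cesaro-like operator\<close>

definition taylor_coeff :: "(complex \<Rightarrow> complex) \<Rightarrow> nat \<Rightarrow> complex" where
  "taylor_coeff f n = (deriv ^^ n) f 0 / fact n"

definition cesaro_op :: "real measure \<Rightarrow> (complex \<Rightarrow> complex) \<Rightarrow> complex \<Rightarrow> complex" where
  "cesaro_op \<mu> f z =
     (if z \<in> ball 0 1
      then \<Sum>n. of_real (\<integral>t. t ^ n \<partial>\<mu>) * (\<Sum>k\<le>n. taylor_coeff f k) * z ^ n
      else 0)"


section \<open>Vanishing Carleson measures\<close>

text \<open>\<open>J\<close> is an angle interval with endpoints \<open>a\<close> and \<open>a + l\<close>, either of which may or may not
  belong to it, so \<open>cis ` J\<close> is an arc of length \<open>l\<close>.\<close>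

definition angle_interval :: "real \<Rightarrow> real \<Rightarrow> real set \<Rightarrow> bool" where
  "angle_interval a l J \<longleftrightarrow> 0 < l \<and> l \<le> 2 * pi \<and> {a<..<a + l} \<subseteq> J \<and> J \<subseteq> {a..a + l}"

definition carleson_box :: "real \<Rightarrow> real set \<Rightarrow> complex set" where
  "carleson_box l J = {of_real r * cis \<theta> | r \<theta>. \<theta> \<in> J \<and> 1 - l / (2 * pi) \<le> r \<and> r < 1}"

definition vanishing_carleson :: "real \<Rightarrow> complex measure \<Rightarrow> bool" where
  "vanishing_carleson s \<nu> \<longleftrightarrow>
     (\<forall>\<epsilon>>0. \<exists>\<delta>>0. \<forall>a l J. angle_interval a l J \<and> l < \<delta> \<longrightarrow>
        emeasure \<nu> (carleson_box l J) / ennreal (l powr s) < ennreal \<epsilon>)"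

definition disc_measure :: "real measure \<Rightarrow> complex measure" where
  "disc_measure \<mu> = distr \<mu> (restrict_space borel (ball 0 1)) complex_of_real"

lemma emeasure_disc_measure:
  assumes \<mu>: "sets \<mu> = sets (restrict_space borel {0..<1})"
    and E: "E \<in> sets borel" "E \<subseteq> ball 0 1"
  shows "emeasure (disc_measure \<mu>) E = emeasure \<mu> {t \<in> {0..<1}. complex_of_real t \<in> E}"
proof -
  have sp: "space \<mu> = {0..<1}"
    using sets_eq_imp_space_eq[OF \<mu>] by (simp add: space_restrict_space)
  have "complex_of_real \<in> measurable (restrict_space borel {0..<1}) (restrict_space borel (ball 0 1))"
    by (intro measurable_restrict_space3) auto
  then have "complex_of_real \<in> measurable \<mu> (restrict_space borel (ball 0 1))"
    using measurable_cong_sets[OF \<mu> refl] by blast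
  then have "emeasure (disc_measure \<mu>) E = emeasure \<mu> (complex_of_real -` E \<inter> space \<mu>)"
    using E unfolding disc_measure_def by (intro emeasure_distr) (auto simp: sets_restrict_space_iff)
  also have "complex_of_real -` E \<inter> space \<mu> = {t \<in> {0..<1}. complex_of_real t \<in> E}"
    by (auto simp: sp)
  finally show ?thesis .
qed

end

theory Submission
  imports Defs
begin

text \<open>With \<open>g(w) = f(w) / (1 - w)\<close>, the Taylor coefficients of \<open>g\<close> are the partial sums of those of \<open>f\<close>,
  so termwise integration gives \<open>(C f)'(z) = \<integral> t g'(tz) d\<mu>(t)\<close>.

  If \<open>\<mu>\<close> is vanishing Carleson, then \<open>\<alpha> > 1\<close> yields \<open>|g'(tz)| \<lesssim> \<parallel>f\<parallel> max (1 - t, 1 - |z|) powr -(\<alpha> + 1)\<close>,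
  and a dyadic decomposition bounds the part of the integral with \<open>t\<close> near \<open>1\<close> by
  \<open>\<epsilon> \<parallel>f\<parallel> (1 - |z|) powr -\<beta>\<close>, while the rest only sees \<open>f\<close> on a compact disc. Hence bounded sequences
  converging to \<open>0\<close> locally uniformly are mapped to null sequences, and Montel's theorem concludes.

  Conversely, the functions \<open>d powr (k + 1 - \<alpha>) / (1 - (1 - d) z) ^ k\<close>, with \<open>k \<ge> \<alpha>\<close> an integer, are bounded in
  \<open>Bloch \<alpha>\<close> and tend to \<open>0\<close> as \<open>d \<rightarrow> 0\<close>, so by compactness their images tend to \<open>0\<close> in norm; evaluating
  the derivative of the image at \<open>1 - d\<close> bounds that norm below by a multiple of
  \<open>\<mu> [1 - d, 1) / d powr (\<alpha> + 1 - \<beta>)\<close>.\<close>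

section \<open>Integral representation of the derivative\<close>

text \<open>The series still converges at an intermediate radius \<open>r\<close> with |z| < r < 1,
  and convergence at \<open>r\<close> gives absolute convergence strictly inside.\<close>

lemma power_series_abs_summable:
  fixes c :: "nat \<Rightarrow> complex"
  assumes c: "\<And>w. cmod w < 1 \<Longrightarrow> summable (\<lambda>n. c n * w ^ n)" and z: "cmod z < 1"
  shows "summable (\<lambda>n. norm (c n * z ^ n))"
proof -
  obtain r where r: "cmod z < r" "r < 1" using z dense by blast
  then have "0 < r" using norm_ge_zero[of z] by linarith
  with r show ?thesis by (intro powser_insidea[of _ "of_real r"] c) auto
qed

text \<open>Dividing by 1 - w is multiplying by the geometric series; the Cauchy product of the two
  absolutely convergent series has the partial sums as coefficients.\<close>

lemma partial_sums_taylor_coeff_sums: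
  assumes f: "f holomorphic_on ball 0 1" and w: "cmod w < 1"
  shows "(\<lambda>n. (\<Sum>k\<le>n. taylor_coeff f k) * w ^ n) sums (f w / (1 - w))"
proof -
  have s: "(\<lambda>n. taylor_coeff f n * v ^ n) sums f v" if "cmod v < 1" for v
    using holomorphic_power_series[OF f, of v] that by (simp add: taylor_coeff_def)
  have "summable (\<lambda>n. norm (taylor_coeff f n * w ^ n))"
    by (rule power_series_abs_summable[OF sums_summable[OF s] w])
  moreover have "summable (\<lambda>n. norm (w ^ n))"
    using w by (simp add: norm_power)
  ultimately have "(\<lambda>n. \<Sum>i\<le>n. taylor_coeff f i * w ^ i * w ^ (n - i)) sums
      ((\<Sum>n. taylor_coeff f n * w ^ n) * (\<Sum>n. w ^ n))"
    by (rule Cauchy_product_sums)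
  moreover have "(\<Sum>i\<le>n. taylor_coeff f i * w ^ i * w ^ (n - i)) = (\<Sum>k\<le>n. taylor_coeff f k) * w ^ n" for n
    by (auto simp: sum_distrib_right mult.assoc simp flip: power_add intro!: sum.cong)
  moreover have "(\<Sum>n. taylor_coeff f n * w ^ n) * (\<Sum>n. w ^ n) = f w / (1 - w)"
    using sums_unique[OF s[OF w]] suminf_geometric[OF w] by simp
  ultimately show ?thesis by simp
qed

text \<open>The space of \<open>\<mu>\<close> is [0,1) itself, not the real line. The bounds 0 \<le>
  t < 1 therefore come from \<open>t \<in> space \<mu>\<close>, and continuity on [0,1) suffices for
  measurability.\<close>

locale radial_measure = finite_measure \<mu> for \<mu> :: "real measure" +
  assumes sets_radial: "sets \<mu> = sets (restrict_space borel {0..<1})"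
begin

lemma space_radial: "space \<mu> = {0..<1}"
  using sets_eq_imp_space_eq[OF sets_radial] by (simp add: space_restrict_space)

lemma atLeastLessThan_in_sets [measurable]: "0 \<le> a \<Longrightarrow> {a..<1} \<in> sets \<mu>"
  unfolding sets_radial by (auto simp: sets_restrict_space_iff)

lemma borel_measurable_radial:
  fixes f :: "real \<Rightarrow> 'b::topological_space"
  assumes "continuous_on {0..<1} f"
  shows "f \<in> borel_measurable \<mu>"
  using borel_measurable_continuous_on_restrict[OF assms] measurable_cong_sets[OF sets_radial refl]
  by blast

lemma integrable_radial:
  fixes f :: "real \<Rightarrow> 'b::{banach, second_countable_topology}"
  assumes "continuous_on {0..<1} f" and "\<And>t. 0 \<le> t \<Longrightarrow> t < 1 \<Longrightarrow> norm (f t) \<le> B"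
  shows "integrable \<mu> f"
  by (rule integrable_const_bound[of _ B]) (use assms borel_measurable_radial space_radial in auto)

lemma integrable_power_radial: "integrable \<mu> (\<lambda>t. t ^ n)"
  by (rule integrable_radial[of _ 1]) (auto intro!: continuous_intros power_le_one)

text \<open>Sum and integral may be interchanged because t^(n + j) \<le> 1 makes |b_n z^n| a
  summable majorant and the total mass is finite. The shift \<open>j\<close> is 0 for the operator
  itself and 1 for its derivative.\<close>

lemma moment_series_sums:
  fixes b :: "nat \<Rightarrow> complex"
  assumes sm: "summable (\<lambda>n. norm (b n * z ^ n))"
  shows "(\<lambda>n. of_real (\<integral>t. t ^ (n + j) \<partial>\<mu>) * b n * z ^ n) sums
    (\<integral>t. of_real (t ^ j) * (\<Sum>n. b n * (of_real t * z) ^ n) \<partial>\<mu>)"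
proof -
  let ?f = "\<lambda>n t. complex_of_real (t ^ (n + j)) * (b n * z ^ n)"
  have int: "integrable \<mu> (?f n)" for n
    by (rule integrable_mult_left) (rule integrable_of_real, rule integrable_power_radial)
  have le: "norm (?f n t) \<le> norm (b n * z ^ n)" if "0 \<le> t" "t < 1" for n t
    using that power_le_one[of t "n + j"] by (auto simp: norm_mult norm_power intro!: mult_left_le_one_le)
  have "(\<lambda>n. integral\<^sup>L \<mu> (?f n)) sums (\<integral>t. (\<Sum>n. ?f n t) \<partial>\<mu>)"
  proof (rule sums_integral[OF int])
    show "AE t in \<mu>. summable (\<lambda>n. norm (?f n t))"
      using le by (intro AE_I2 summable_comparison_test[OF _ sm]) (auto simp: space_radial)
    show "summable (\<lambda>n. \<integral>t. norm (?f n t) \<partial>\<mu>)"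
    proof (rule summable_comparison_test[OF _ summable_mult[OF sm, of "measure \<mu> (space \<mu>)"]], intro exI allI impI)
      fix n
      have "(\<integral>t. norm (?f n t) \<partial>\<mu>) \<le> (\<integral>t. norm (b n * z ^ n) \<partial>\<mu>)"
        using int le by (intro integral_mono) (auto simp: space_radial)
      then show "norm (\<integral>t. norm (?f n t) \<partial>\<mu>) \<le> measure \<mu> (space \<mu>) * norm (b n * z ^ n)"
        by simp
    qed
  qed
  moreover have "integral\<^sup>L \<mu> (?f n) = of_real (\<integral>t. t ^ (n + j) \<partial>\<mu>) * b n * z ^ n" for n
    by (simp only: integral_mult_left_zero integral_complex_of_real mult.assoc)
  moreover have "(\<integral>t. (\<Sum>n. ?f n t) \<partial>\<mu>) = (\<integral>t. of_real (t ^ j) * (\<Sum>n. b n * (of_real t * z) ^ n) \<partial>\<mu>)"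
  proof (rule Bochner_Integration.integral_cong[OF refl])
    fix t assume "t \<in> space \<mu>"
    then have t: "0 \<le> t" "t < 1" by (auto simp: space_radial)
    have "norm (b n * (of_real t * z) ^ n) \<le> norm (b n * z ^ n)" for n
      using t power_le_one[of t n]
      by (auto simp: norm_mult norm_power power_mult_distrib intro!: mult_left_mono mult_left_le_one_le)
    then have "summable (\<lambda>n. b n * (of_real t * z) ^ n)"
      by (intro summable_comparison_test[OF _ sm]) auto
    then have "of_real (t ^ j) * (\<Sum>n. b n * (of_real t * z) ^ n) = (\<Sum>n. of_real (t ^ j) * (b n * (of_real t * z) ^ n))"
      by (rule suminf_mult[symmetric])
    then show "(\<Sum>n. ?f n t) = of_real (t ^ j) * (\<Sum>n. b n * (of_real t * z) ^ n)"
      by (simp add: power_add power_mult_distrib mult_ac)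
  qed
  ultimately show ?thesis
    by (simp only:)
qed

text \<open>Only the term n = 0 survives at the origin, and the zeroth moment is the total mass.
  This controls the |f(0)| part of the Bloch norm.\<close>

lemma cesaro_op_at_0: "cesaro_op \<mu> f 0 = of_real (measure \<mu> (space \<mu>)) * f 0"
  using powser_zero[of "\<lambda>n. of_real (\<integral>t. t ^ n \<partial>\<mu>) * (\<Sum>k\<le>n. taylor_coeff f k)"]
  by (simp add: cesaro_op_def taylor_coeff_def)

text \<open>Both the image of f and \<open>g\<close> = f / (1 - w) are differentiated as power
  series; the derivative series of the image is then the moment series of that of \<open>g\<close>
  with moments shifted by one, whence the factor t in the integrand.\<close>

lemma has_field_derivative_cesaro_op:
  assumes f: "f holomorphic_on ball 0 1" and z: "cmod z < 1"
  shows "(cesaro_op \<mu> f has_field_derivative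
    (\<integral>t. of_real t * deriv (\<lambda>w. f w / (1 - w)) (of_real t * z) \<partial>\<mu>)) (at z)"
proof -
  define c where "c n = (\<Sum>k\<le>n. taylor_coeff f k)" for n
  define m where "m n = complex_of_real (\<integral>t. t ^ n \<partial>\<mu>)" for n
  define g where "g = (\<lambda>w. f w / (1 - w))"
  have cs: "(\<lambda>n. c n * w ^ n) sums g w" if "cmod w < 1" for w
    using partial_sums_taylor_coeff_sums[OF f that] by (simp add: c_def g_def)
  have c_abs: "summable (\<lambda>n. norm (c n * w ^ n))" if "cmod w < 1" for w
    by (rule power_series_abs_summable[OF sums_summable[OF cs] that])
  have dc: "summable (\<lambda>n. diffs c n * w ^ n)" if "cmod w < 1" for w
    by (rule termdiff_converges[OF that sums_summable[OF cs]])
  have dc_abs: "summable (\<lambda>n. norm (diffs c n * w ^ n))" if "cmod w < 1" for w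
    using dc that by (rule power_series_abs_summable)
  have dg: "deriv g w = (\<Sum>n. diffs c n * w ^ n)" if w: "cmod w < 1" for w
  proof -
    have "((\<lambda>w. \<Sum>n. c n * w ^ n) has_field_derivative (\<Sum>n. diffs c n * w ^ n)) (at w)"
      by (rule termdiffs_strong'[OF sums_summable[OF cs] w])
    then have "(g has_field_derivative (\<Sum>n. diffs c n * w ^ n)) (at w)"
      by (rule has_field_derivative_transform_within_open[of _ _ _ "ball 0 1"])
        (use w sums_unique[OF cs] in auto)
    then show ?thesis by (rule DERIV_imp_deriv)
  qed
  have ms: "summable (\<lambda>n. m n * c n * w ^ n)" if "cmod w < 1" for w
    using sums_summable[OF moment_series_sums[OF c_abs[OF that], of 0]] by (simp add: m_def)
  have "((\<lambda>w. \<Sum>n. m n * c n * w ^ n) has_field_derivative (\<Sum>n. diffs (\<lambda>n. m n * c n) n * z ^ n)) (at z)"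
    by (rule termdiffs_strong'[OF ms z])
  then have "(cesaro_op \<mu> f has_field_derivative (\<Sum>n. diffs (\<lambda>n. m n * c n) n * z ^ n)) (at z)"
    by (rule has_field_derivative_transform_within_open[of _ _ _ "ball 0 1"])
      (use z in \<open>auto simp: cesaro_op_def m_def c_def\<close>)
  \<comment> \<open>The n-th coefficient is (n + 1) m_(n+1) c_(n+1) = m_(n+1) *
    \<open>diffs c n\<close>, so the moment lemma applies with \<open>j\<close> = 1.\<close>
  moreover have "(\<lambda>n. diffs (\<lambda>n. m n * c n) n * z ^ n) sums
      (\<integral>t. of_real (t ^ 1) * (\<Sum>n. diffs c n * (of_real t * z) ^ n) \<partial>\<mu>)"
    using moment_series_sums[OF dc_abs[OF z], of 1] by (simp add: diffs_def m_def mult_ac)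
  moreover have "(\<integral>t. of_real (t ^ 1) * (\<Sum>n. diffs c n * (of_real t * z) ^ n) \<partial>\<mu>)
      = (\<integral>t. of_real t * deriv g (of_real t * z) \<partial>\<mu>)"
  proof (rule Bochner_Integration.integral_cong[OF refl])
    fix t assume "t \<in> space \<mu>"
    then have "cmod (of_real t * z) < 1"
      using z mult_left_le_one_le[of "cmod z" t] by (auto simp: space_radial norm_mult)
    then show "of_real (t ^ 1) * (\<Sum>n. diffs c n * (of_real t * z) ^ n) = of_real t * deriv g (of_real t * z)"
      by (simp add: dg)
  qed
  ultimately show ?thesis
    unfolding g_def by (simp only: sums_iff)
qed

lemma cesaro_op_in_hol_disc:
  assumes "f \<in> hol_disc"
  shows "cesaro_op \<mu> f \<in> hol_disc"
proof -
  have "f holomorphic_on ball 0 1" using assms by (simp add: hol_disc_def)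
  from has_field_derivative_cesaro_op[OF this] have "cesaro_op \<mu> f holomorphic_on ball 0 1"
    unfolding holomorphic_on_open[OF open_ball] by (metis mem_ball_0)
  then show ?thesis by (simp add: hol_disc_def cesaro_op_def)
qed

text \<open>This turns convergence of images to the image of a limit into a statement about null
  sequences. The two series may be subtracted because each converges in the disc.\<close>

lemma cesaro_op_diff:
  assumes f: "f \<in> hol_disc" and g: "g \<in> hol_disc"
  shows "cesaro_op \<mu> (\<lambda>z. f z - g z) = (\<lambda>z. cesaro_op \<mu> f z - cesaro_op \<mu> g z)"
proof
  fix z
  show "cesaro_op \<mu> (\<lambda>z. f z - g z) z = cesaro_op \<mu> f z - cesaro_op \<mu> g z"
  proof (cases "z \<in> ball 0 1")
    case True
    then have z: "cmod z < 1" by simp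
    have hol: "f holomorphic_on ball 0 1" "g holomorphic_on ball 0 1"
      using f g by (auto simp: hol_disc_def)
    have sm: "summable (\<lambda>n. of_real (\<integral>t. t ^ n \<partial>\<mu>) * (\<Sum>k\<le>n. taylor_coeff h k) * z ^ n)"
      if h: "h holomorphic_on ball 0 1" for h
    proof -
      have "summable (\<lambda>n. norm ((\<Sum>k\<le>n. taylor_coeff h k) * z ^ n))"
        by (rule power_series_abs_summable[OF sums_summable[OF partial_sums_taylor_coeff_sums[OF h]] z])
      from sums_summable[OF moment_series_sums[OF this, of 0]] show ?thesis by simp
    qed
    have tc: "taylor_coeff (\<lambda>z. f z - g z) n = taylor_coeff f n - taylor_coeff g n" for n
      using higher_deriv_diff[OF hol open_ball, of 0 n] by (simp add: taylor_coeff_def diff_divide_distrib)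
    show ?thesis
      unfolding cesaro_op_def if_P[OF True] suminf_diff[OF sm[OF hol(1)] sm[OF hol(2)]] tc sum_subtractf
      by (simp add: algebra_simps)
  next
    case False
    then show ?thesis by (simp add: cesaro_op_def)
  qed
qed

end

section \<open>Carleson measures on the radius\<close>

text \<open>The box is the image of a compact rectangle of polar coordinates, with the points of
  radius 1 removed by intersecting with the open disc. The bound l \<le> 2 pi keeps radii
  nonnegative, so that the modulus of a point is its radius.\<close>

lemma closed_carleson_box_borel:
  assumes "0 \<le> l" "l \<le> 2 * pi"
  shows "carleson_box l {a..b} \<in> sets borel"
proof -
  let ?K = "(\<lambda>(r, \<theta>). complex_of_real r * cis \<theta>) ` ({1 - l / (2 * pi)..1} \<times> {a..b})"
  have "0 \<le> 1 - l / (2 * pi)"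
    using assms by (simp add: field_simps)
  then have pos: "0 \<le> r" if "1 - l / (2 * pi) \<le> r" for r
    using that by linarith
  have "carleson_box l {a..b} = ?K \<inter> ball 0 1"
  proof safe
    fix z assume "z \<in> carleson_box l {a..b}"
    then obtain r \<theta> where z: "z = of_real r * cis \<theta>" "1 - l / (2 * pi) \<le> r" "r < 1" "\<theta> \<in> {a..b}"
      by (auto simp: carleson_box_def)
    then show "z \<in> ?K" by (intro image_eqI[of _ _ "(r, \<theta>)"]) auto
    show "z \<in> ball 0 1" using z pos by (simp add: norm_mult)
  next
    fix r \<theta> assume r: "r \<in> {1 - l / (2 * pi)..1}" "\<theta> \<in> {a..b}"
      and "complex_of_real r * cis \<theta> \<in> ball 0 1"
    then have "r < 1" by (simp add: norm_mult)
    with r show "complex_of_real r * cis \<theta> \<in> carleson_box l {a..b}"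
      unfolding carleson_box_def by (intro CollectI exI[of _ r] exI[of _ \<theta>]) auto
  qed
  moreover have "compact ?K"
    by (intro compact_continuous_image compact_Times compact_Icc)
      (auto intro!: continuous_intros simp: case_prod_unfold cis_conv_exp)
  ultimately show ?thesis
    by (metis borel_closed borel_open compact_imp_closed open_ball sets.Int)
qed

lemma carleson_box_subset_ball: "0 \<le> l \<Longrightarrow> l \<le> 2 * pi \<Longrightarrow> carleson_box l J \<subseteq> ball 0 1"
proof
  fix z assume l: "0 \<le> l" "l \<le> 2 * pi" and "z \<in> carleson_box l J"
  then obtain r \<theta> where "z = of_real r * cis \<theta>" "1 - l / (2 * pi) \<le> r" "r < 1"
    by (auto simp: carleson_box_def)
  moreover have "0 \<le> 1 - l / (2 * pi)"
    using l by (simp add: field_simps)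
  ultimately have "0 \<le> r" by linarith
  then show "z \<in> ball 0 1"
    using \<open>z = _\<close> \<open>r < 1\<close> by (simp add: norm_mult)
qed

section \<open>Carleson boxes versus tails of the radial measure, and a dyadic estimate\<close>

context radial_measure
begin

text \<open>A point t of [0,1) in the box equals its own polar radius, as both are nonnegative, so
  it lies in the tail whatever \<open>J\<close> is. For a nonmeasurable box the value of
  \<open>emeasure\<close> is 0 by convention.\<close>

lemma emeasure_disc_measure_carleson_box_le:
  assumes l: "0 < l" "l \<le> 2 * pi"
  shows "emeasure (disc_measure \<mu>) (carleson_box l J) \<le> emeasure \<mu> {1 - l / (2 * pi)..<1}"
proof (cases "carleson_box l J \<in> sets (disc_measure \<mu>)")
  case True
  have l0: "0 \<le> 1 - l / (2 * pi)"
    using l by (simp add: field_simps)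
  have "carleson_box l J \<in> sets borel" "carleson_box l J \<subseteq> ball 0 1"
    using True by (auto simp: disc_measure_def sets_restrict_space_iff)
  then have "emeasure (disc_measure \<mu>) (carleson_box l J)
      = emeasure \<mu> {t \<in> {0..<1}. complex_of_real t \<in> carleson_box l J}"
    by (rule emeasure_disc_measure[OF sets_radial])
  also have "\<dots> \<le> emeasure \<mu> {1 - l / (2 * pi)..<1}"
  proof (rule emeasure_mono)
    show "{t \<in> {0..<1}. complex_of_real t \<in> carleson_box l J} \<subseteq> {1 - l / (2 * pi)..<1}"
    proof safe
      fix t assume t: "t \<in> {0..<1}" "complex_of_real t \<in> carleson_box l J"
      then obtain r \<theta> where r: "complex_of_real t = of_real r * cis \<theta>" "1 - l / (2 * pi) \<le> r"
        by (auto simp: carleson_box_def)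
      from arg_cong[OF r(1), of cmod] have "t = r"
        using t(1) r(2) l0 by (simp add: norm_mult)
      then show "t \<in> {1 - l / (2 * pi)..<1}"
        using t r by simp
    qed
  qed (use l0 in auto)
  finally show ?thesis .
qed (simp add: emeasure_notin_sets)

text \<open>With l = 2 pi x, the box over an arc centred at 1 contains the segment [1 - x, 1), while
  any box of length l meets the radius only inside that segment. The powers of 2 pi in the constants
  convert l powr s into x powr s.\<close>

lemma vanishing_carleson_disc_measure_iff:
  "vanishing_carleson s (disc_measure \<mu>) \<longleftrightarrow>
    (\<forall>\<epsilon>>0. \<exists>x0. 0 < x0 \<and> x0 \<le> 1 \<and> (\<forall>x. 0 < x \<and> x \<le> x0 \<longrightarrow> measure \<mu> {1 - x..<1} \<le> \<epsilon> * x powr s))"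
  (is "?L \<longleftrightarrow> ?R")
proof
  assume L: ?L
  show ?R
  proof (intro allI impI)
    fix \<epsilon> :: real assume \<epsilon>: "0 < \<epsilon>"
    define e where "e = \<epsilon> / (2 * pi) powr s"
    have "0 < e" using \<epsilon> by (simp add: e_def)
    then obtain \<delta> where \<delta>: "\<delta> > 0" and box: "\<And>a l J. angle_interval a l J \<and> l < \<delta> \<Longrightarrow>
        emeasure (disc_measure \<mu>) (carleson_box l J) / ennreal (l powr s) < ennreal e"
      using L unfolding vanishing_carleson_def by metis
    \<comment> \<open>The bound 1 keeps l = 2 pi x at most 2 pi; the other bound gives l \<le>
      \<delta> / 2, hence the strict inequality l < \<delta>.\<close>
    define x0 where "x0 = min 1 (\<delta> / (4 * pi))"
    have "measure \<mu> {1 - x..<1} \<le> \<epsilon> * x powr s" if x: "0 < x" "x \<le> x0" for x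
    proof -
      define l where "l = 2 * pi * x"
      have x1: "x \<le> 1" and "x \<le> \<delta> / (4 * pi)" using x by (auto simp: x0_def)
      then have "l \<le> \<delta> / 2" by (simp add: l_def field_simps)
      then have l: "0 < l" "l \<le> 2 * pi" "l < \<delta>"
        using x x1 \<delta> by (auto simp: l_def)
      have lx: "1 - l / (2 * pi) = 1 - x" by (simp add: l_def)
      let ?B = "carleson_box l {- (l / 2)..l / 2}"
      have "angle_interval (- (l / 2)) l {- (l / 2)..l / 2}"
        using l by (auto simp: angle_interval_def)
      note B = box[OF conjI[OF this l(3)]]
      have "emeasure \<mu> {1 - x..<1} \<le> emeasure \<mu> {t \<in> {0..<1}. complex_of_real t \<in> ?B}"
      proof (rule emeasure_mono)
        show "{1 - x..<1} \<subseteq> {t \<in> {0..<1}. complex_of_real t \<in> ?B}"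
        proof safe
          fix t assume t: "t \<in> {1 - x..<1}"
          then show "t \<in> {0..<1}" using x1 by auto
          have "complex_of_real t = of_real t * cis 0" by simp
          then show "complex_of_real t \<in> ?B"
            unfolding carleson_box_def lx using t l by (intro CollectI exI[of _ t] exI[of _ 0]) auto
        qed
        have "{t \<in> {0..<1}. complex_of_real t \<in> ?B} = {0..<1} \<inter> complex_of_real -` ?B"
          by auto
        moreover have "complex_of_real -` ?B \<in> sets borel"
          using measurable_sets[of complex_of_real borel borel ?B] closed_carleson_box_borel l by simp
        ultimately show "{t \<in> {0..<1}. complex_of_real t \<in> ?B} \<in> sets \<mu>"
          unfolding sets_radial by (simp add: sets_restrict_space_iff)
      qed
      also have "\<dots> = emeasure (disc_measure \<mu>) ?B"
        using l by (intro emeasure_disc_measure[symmetric] sets_radial closed_carleson_box_borel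
          carleson_box_subset_ball) auto
      finally have "ennreal (measure \<mu> {1 - x..<1}) / ennreal (l powr s)
          \<le> emeasure (disc_measure \<mu>) ?B / ennreal (l powr s)"
        unfolding emeasure_eq_measure by (rule divide_right_mono_ennreal)
      also note B
      finally have "measure \<mu> {1 - x..<1} / l powr s < e"
        using l \<open>0 < e\<close> by (simp add: divide_ennreal ennreal_less_iff)
      then have "measure \<mu> {1 - x..<1} < e * l powr s"
        using l by (simp add: field_simps)
      also have "\<dots> = \<epsilon> * x powr s"
        using x by (simp add: e_def l_def powr_mult)
      finally show ?thesis by simp
    qed
    moreover have "0 < x0" "x0 \<le> 1" using \<delta> by (auto simp: x0_def)
    ultimately show "\<exists>x0. 0 < x0 \<and> x0 \<le> 1 \<and> (\<forall>x. 0 < x \<and> x \<le> x0 \<longrightarrow> measure \<mu> {1 - x..<1} \<le> \<epsilon> * x powr s)"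
      by blast
  qed
next
  assume R: ?R
  show ?L
    unfolding vanishing_carleson_def
  proof (intro allI impI)
    fix \<epsilon> :: real assume \<epsilon>: "0 < \<epsilon>"
    \<comment> \<open>The tail bound is not strict but the Carleson condition is, hence the
      half.\<close>
    define e where "e = \<epsilon> / 2 * (2 * pi) powr s"
    have "0 < e" using \<epsilon> by (simp add: e_def)
    then obtain x0 where x0: "0 < x0" "x0 \<le> 1"
      and m: "\<And>x. 0 < x \<Longrightarrow> x \<le> x0 \<Longrightarrow> measure \<mu> {1 - x..<1} \<le> e * x powr s"
      using R by blast
    have "emeasure (disc_measure \<mu>) (carleson_box l J) / ennreal (l powr s) < ennreal \<epsilon>"
      if J: "angle_interval a l J" and lx0: "l < 2 * pi * x0" for a l J
    proof -
      have l: "0 < l" "l \<le> 2 * pi" using J by (auto simp: angle_interval_def)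
      define x where "x = l / (2 * pi)"
      have x: "0 < x" "x \<le> x0" using l lx0 by (auto simp: x_def field_simps)
      have "measure \<mu> {1 - x..<1} / l powr s \<le> e * x powr s / l powr s"
        using m[OF x] by (rule divide_right_mono) simp
      also have "\<dots> = \<epsilon> / 2"
        using l by (simp add: e_def x_def powr_divide)
      also have "\<dots> < \<epsilon>" using \<epsilon> by simp
      finally have *: "ennreal (measure \<mu> {1 - x..<1} / l powr s) < ennreal \<epsilon>"
        using \<epsilon> by (simp add: ennreal_less_iff)
      have "emeasure (disc_measure \<mu>) (carleson_box l J) / ennreal (l powr s)
          \<le> emeasure \<mu> {1 - x..<1} / ennreal (l powr s)"
        unfolding x_def by (intro divide_right_mono_ennreal emeasure_disc_measure_carleson_box_le l)
      also have "\<dots> = ennreal (measure \<mu> {1 - x..<1} / l powr s)"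
        using l by (simp add: emeasure_eq_measure divide_ennreal)
      also note *
      finally show ?thesis .
    qed
    then show "\<exists>\<delta>>0. \<forall>a l J. angle_interval a l J \<and> l < \<delta> \<longrightarrow>
        emeasure (disc_measure \<mu>) (carleson_box l J) / ennreal (l powr s) < ennreal \<epsilon>"
      using x0 by (intro exI[of _ "2 * pi * x0"]) auto
  qed
qed

text \<open>Where 2^k d \<le> max (1 - t) d < 2^(k+1) d, the integrand is at most (2^k d) powr -(s +
  \<beta>) and the tail has mass at most \<epsilon> (2^(k+1) d) powr s. The products decay like 2
  powr -(\<beta> k), and the geometric series converges since \<beta> > 0.\<close>

lemma integral_max_powr_le:
  fixes s \<beta> \<epsilon> d x0 :: real
  assumes s: "0 < s" and \<beta>: "0 < \<beta>" and \<epsilon>: "0 \<le> \<epsilon>" and x0: "0 < x0" "x0 \<le> 1" and d: "0 < d"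
    and m: "\<And>x. 0 < x \<Longrightarrow> x \<le> x0 \<Longrightarrow> measure \<mu> {1 - x..<1} \<le> \<epsilon> * x powr s"
  shows "(\<integral>t. indicator {1 - x0..<1} t * max (1 - t) d powr - (s + \<beta>) \<partial>\<mu>)
    \<le> \<epsilon> * (2 powr s / (1 - 2 powr - \<beta>)) * d powr - \<beta>"
proof -
  \<comment> \<open>Nested tails take the place of disjoint shells, as only an upper bound is
    sought; they are cut at \<open>x0\<close> because the tail estimate holds only up to
    there.\<close>
  define B where "B k = {1 - min x0 (2 ^ Suc k * d)..<1}" for k :: nat
  define c where "c k = (2 ^ k * d) powr - (s + \<beta>)" for k :: nat
  have B_sets [measurable]: "B k \<in> sets \<mu>" for k
    using x0 unfolding B_def by (intro atLeastLessThan_in_sets) auto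
  have mB: "c k * measure \<mu> (B k) \<le> \<epsilon> * 2 powr s * d powr - \<beta> * (2 powr - \<beta>) ^ k" for k
  proof -
    have "measure \<mu> (B k) \<le> \<epsilon> * min x0 (2 ^ Suc k * d) powr s"
      unfolding B_def using x0 d by (intro m) auto
    also have "\<dots> \<le> \<epsilon> * (2 ^ Suc k * d) powr s"
      using x0 d s \<epsilon> by (intro mult_left_mono powr_mono2) auto
    also have "\<dots> = \<epsilon> * 2 powr s * (2 ^ k * d) powr s"
      using d by (simp add: powr_mult mult_ac)
    finally have "c k * measure \<mu> (B k) \<le> c k * (\<epsilon> * 2 powr s * (2 ^ k * d) powr s)"
      by (rule mult_left_mono) (simp add: c_def)
    also have "\<dots> = \<epsilon> * 2 powr s * ((2 ^ k * d) powr - (s + \<beta>) * (2 ^ k * d) powr s)"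
      by (simp add: c_def)
    also have "(2 ^ k * d) powr - (s + \<beta>) * (2 ^ k * d) powr s = (2 ^ k * d) powr - \<beta>"
      by (simp flip: powr_add)
    also have "\<dots> = (2 powr - \<beta>) ^ k * d powr - \<beta>"
      using d by (simp add: powr_mult powr_powr powr_realpow[symmetric] mult.commute)
    finally show ?thesis by (simp add: mult_ac)
  qed
  obtain K0 where "1 / d < 2 ^ K0"
    using real_arch_pow[of 2 "1 / d"] by auto
  \<comment> \<open>Now 2^K d exceeds 1 \<ge> 1 - t, and since \<open>K\<close> is positive it also
    exceeds d; hence \<open>K\<close> shells cover every t.\<close>
  moreover define K where "K = Suc K0"
  ultimately have K: "1 < 2 ^ K * d" "0 < K"
    using d by (auto simp: field_simps)
  have pw: "indicator {1 - x0..<1} t * max (1 - t) d powr - (s + \<beta>) \<le> (\<Sum>k<K. c k * indicator (B k) t)"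
    if t: "t \<in> space \<mu>" for t
  proof (cases "t \<in> {1 - x0..<1}")
    case True
    define M where "M = max (1 - t) d"
    have "M < 2 ^ K * d"
      using t K d one_less_power[of "2::real" K] by (auto simp: M_def space_radial)
    have "\<exists>k. M < 2 ^ Suc k * d" 
      using \<open>M < 2 ^ K * d\<close> K by (intro exI[of _ "K - 1"]) auto
    define k where "k = (LEAST k. M < 2 ^ Suc k * d)"
    have k1: "M < 2 ^ Suc k * d"
      unfolding k_def using \<open>\<exists>k. _\<close> by (rule LeastI_ex)
    have kK: "k < K"
      using Least_le[of "\<lambda>k. M < 2 ^ Suc k * d" "K - 1"] \<open>M < 2 ^ K * d\<close> K by (auto simp: k_def)
    \<comment> \<open>For k > 0 this is minimality of \<open>k\<close>; for k = 0 it is the d inside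
      the maximum.\<close>
    have k2: "2 ^ k * d \<le> M"
    proof (cases k)
      case (Suc j)
      then have "\<not> M < 2 ^ Suc j * d"
        using not_less_Least[of j "\<lambda>k. M < 2 ^ Suc k * d"] by (simp add: k_def)
      then show ?thesis using Suc by simp
    qed (simp add: M_def)
    have "M powr - (s + \<beta>) \<le> c k"
      unfolding c_def using k2 d s \<beta> by (intro powr_mono2') auto
    moreover have "t \<in> B k"
      using True k1 by (auto simp: B_def M_def)
    ultimately have "M powr - (s + \<beta>) \<le> c k * indicator (B k) t"
      by simp
    also have "\<dots> \<le> (\<Sum>k<K. c k * indicator (B k) t)"
      using kK by (intro member_le_sum) (auto simp: c_def)
    finally show ?thesis using True by (simp add: M_def)
  next
    case False
    then show ?thesis by (auto intro!: sum_nonneg simp: c_def)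
  qed
  have int: "integrable \<mu> (\<lambda>t. c k * indicator (B k) t)" for k
    by (intro integrable_mult_right integrable_real_indicator) (auto simp: emeasure_eq_measure)
  have "(\<integral>t. indicator {1 - x0..<1} t * max (1 - t) d powr - (s + \<beta>) \<partial>\<mu>)
      \<le> (\<integral>t. (\<Sum>k<K. c k * indicator (B k) t) \<partial>\<mu>)"
    by (intro integral_mono' Bochner_Integration.integrable_sum int pw sum_nonneg) (simp_all add: c_def)
  also have "\<dots> = (\<Sum>k<K. c k * measure \<mu> (B k))"
    using sets.sets_into_space[OF B_sets]
    by (subst Bochner_Integration.integral_sum[OF int]) (simp add: Int_absorb2)
  also have "\<dots> \<le> (\<Sum>k<K. \<epsilon> * 2 powr s * d powr - \<beta> * (2 powr - \<beta>) ^ k)"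
    by (intro sum_mono mB)
  also have "\<dots> = \<epsilon> * 2 powr s * d powr - \<beta> * (\<Sum>k<K. (2 powr - \<beta>) ^ k)"
    by (simp add: sum_distrib_left)
  also have "\<dots> \<le> \<epsilon> * 2 powr s * d powr - \<beta> * (1 / (1 - 2 powr - \<beta>))"
  proof (rule mult_left_mono)
    have "(2::real) powr - \<beta> < 2 powr 0"
      using \<beta> by (intro powr_less_mono) auto
    then have "norm ((2::real) powr - \<beta>) < 1" by simp
    then have "(\<Sum>k<K. (2 powr - \<beta>) ^ k) \<le> (\<Sum>k. (2 powr - \<beta>) ^ k)"
      by (intro sum_le_suminf summable_geometric) auto
    with suminf_geometric[OF \<open>norm _ < 1\<close>] show "(\<Sum>k<K. (2 powr - \<beta>) ^ k) \<le> 1 / (1 - 2 powr - \<beta>)"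
      by simp
  qed (use \<epsilon> in simp)
  finally show ?thesis by (simp add: mult_ac)
qed

end

section \<open>Growth of Bloch functions and the weight estimate\<close>

lemma bloch_norm_nonneg: "f \<in> Bloch \<alpha> \<Longrightarrow> 0 \<le> bloch_norm \<alpha> f"
  using SUP_bloch_weight_nonneg by (simp add: bloch_norm_def)

lemma bloch_weight_nonneg: "0 \<le> bloch_weight \<alpha> f z"
  by (simp add: bloch_weight_def)

lemma bloch_weight_le_norm:
  assumes "f \<in> Bloch \<alpha>" "cmod z < 1"
  shows "bloch_weight \<alpha> f z \<le> bloch_norm \<alpha> f"
  using bloch_weight_le_SUP[OF assms(1), of z] assms(2) by (simp add: bloch_norm_def add_increasing)

lemma norm_at_0_le_bloch_norm: "f \<in> Bloch \<alpha> \<Longrightarrow> cmod (f 0) \<le> bloch_norm \<alpha> f"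
  using SUP_bloch_weight_nonneg by (simp add: bloch_norm_def)

lemma BlochI:
  assumes "f \<in> hol_disc" "\<And>z. cmod z < 1 \<Longrightarrow> bloch_weight \<alpha> f z \<le> B"
  shows "f \<in> Bloch \<alpha>"
  using assms by (auto simp: Bloch_def intro!: bdd_aboveI2[of _ _ B])

lemma bloch_norm_le:
  assumes "\<And>z. cmod z < 1 \<Longrightarrow> bloch_weight \<alpha> f z \<le> B"
  shows "bloch_norm \<alpha> f \<le> cmod (f 0) + B"
  unfolding bloch_norm_def using assms by (intro add_left_mono cSUP_least) auto

lemma Bloch_holomorphic: "f \<in> Bloch \<alpha> \<Longrightarrow> f holomorphic_on ball 0 1"
  by (simp add: Bloch_def hol_disc_def)

lemma cmod_deriv_le_bloch_norm:
  assumes "0 \<le> \<alpha>" "f \<in> Bloch \<alpha>" "cmod z < 1"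
  shows "cmod (deriv f z) \<le> bloch_norm \<alpha> f * (1 - cmod z) powr - \<alpha>"
proof -
  have "(cmod z)\<^sup>2 \<le> cmod z"
    using assms(3) by (simp add: power2_eq_square mult_left_le_one_le)
  then have "(1 - cmod z) powr \<alpha> \<le> (1 - (cmod z)\<^sup>2) powr \<alpha>"
    using assms by (intro powr_mono2) auto
  then have "(1 - cmod z) powr \<alpha> * cmod (deriv f z) \<le> bloch_weight \<alpha> f z"
    unfolding bloch_weight_def by (rule mult_right_mono) simp
  also have "\<dots> \<le> bloch_norm \<alpha> f"
    using assms by (intro bloch_weight_le_norm)
  finally show ?thesis
    using assms(3) by (simp add: powr_minus field_simps)
qed

text \<open>The derivative bound is integrated along the radius from 0 to z. For \<alpha> > 1 the
  integral is at most (1 - |z|) powr (1 - \<alpha>) / (\<alpha> - 1); absorbing |f(0)| adds 1 to the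
  constant, and 1 / (\<alpha> - 1) + 1 = \<alpha> / (\<alpha> - 1).\<close>

lemma cmod_le_bloch_norm:
  assumes \<alpha>: "1 < \<alpha>" and f: "f \<in> Bloch \<alpha>" and z: "cmod z < 1"
  shows "cmod (f z) \<le> bloch_norm \<alpha> f * (\<alpha> / (\<alpha> - 1)) * (1 - cmod z) powr (1 - \<alpha>)"
proof -
  define r where "r = cmod z"
  define N where "N = bloch_norm \<alpha> f"
  have r: "0 \<le> r" "r < 1" using z by (auto simp: r_def)
  have N: "0 \<le> N" using f bloch_norm_nonneg by (simp add: N_def)
  have sr: "0 < 1 - s * r" if "s \<le> 1" for s
    using that r mult_right_mono[of s 1 r] by simp
  have sz: "cmod (of_real s * z) < 1" if "0 \<le> s" "s \<le> 1" for s
    using that sr[of s] by (simp add: norm_mult r_def)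
  \<comment> \<open>This is an antiderivative of the bound N r (1 - s r) powr -\<alpha> on the speed
    of s \<mapsto> f(s z).\<close>
  define \<phi> where "\<phi> = (\<lambda>s. N / (\<alpha> - 1) * (1 - s * r) powr (1 - \<alpha>))"
  have df: "((\<lambda>s. f (of_real s * z)) has_vector_derivative z * deriv f (of_real s * z)) (at s)"
    if "0 \<le> s" "s \<le> 1" for s
  proof -
    have "(f has_field_derivative deriv f (of_real s * z)) (at (of_real s * z))"
      using Bloch_holomorphic[OF f] sz[OF that] by (intro holomorphic_derivI[of _ "ball 0 1"]) auto
    moreover have "((\<lambda>s. of_real s * z) has_vector_derivative z) (at s)"
      by (auto intro!: derivative_eq_intros)
    ultimately show ?thesis
      using field_vector_diff_chain_at by (fastforce simp: o_def)
  qed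
  have dphi: "(\<phi> has_vector_derivative N * r * (1 - s * r) powr - \<alpha>) (at s)" if "s \<le> 1" for s
  proof -
    have "((\<lambda>s. (1 - s * r) powr (1 - \<alpha>)) has_real_derivative (\<alpha> - 1) * (r * (1 - s * r) powr - \<alpha>)) (at s)"
      using sr[OF that] by (auto intro!: derivative_eq_intros simp: algebra_simps powr_minus)
    from DERIV_cmult[OF this, of "N / (\<alpha> - 1)"] show ?thesis
      using \<alpha> by (simp add: \<phi>_def has_real_derivative_iff_has_vector_derivative mult_ac)
  qed
  have "norm (f (of_real 1 * z) - f (of_real 0 * z)) \<le> \<phi> 1 - \<phi> 0"
  proof (rule differentiable_bound_general)
    show "continuous_on {0..1} (\<lambda>s. f (of_real s * z))" "continuous_on {0..1} \<phi>"
      by (auto intro!: continuous_at_imp_continuous_on has_vector_derivative_continuous[OF df]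
          has_vector_derivative_continuous[OF dphi])
    show "cmod (z * deriv f (of_real s * z)) \<le> N * r * (1 - s * r) powr - \<alpha>" if "0 < s" "s < 1" for s
      using cmod_deriv_le_bloch_norm[of \<alpha> f "of_real s * z"] f \<alpha> sz[of s] that r
      by (auto simp: norm_mult N_def r_def mult_ac intro!: mult_left_mono)
  qed (use df dphi in auto)
  then have "cmod (f z - f 0) \<le> N / (\<alpha> - 1) * ((1 - r) powr (1 - \<alpha>) - 1)"
    by (simp add: \<phi>_def right_diff_distrib)
  also have "\<dots> \<le> N / (\<alpha> - 1) * (1 - r) powr (1 - \<alpha>)"
    using N \<alpha> by (intro mult_left_mono) auto
  finally have 1: "cmod (f z - f 0) \<le> N / (\<alpha> - 1) * (1 - r) powr (1 - \<alpha>)" .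
  have "1 \<le> (1 - r) powr (1 - \<alpha>)"
    using r \<alpha> powr_mono2'[of "1 - \<alpha>" "1 - r" 1] by simp
  then have "cmod (f 0) \<le> N * (1 - r) powr (1 - \<alpha>)"
    using norm_at_0_le_bloch_norm[OF f] N mult_left_mono[of 1 _ N] by (force simp: N_def)
  then have "cmod (f z) \<le> N / (\<alpha> - 1) * (1 - r) powr (1 - \<alpha>) + N * (1 - r) powr (1 - \<alpha>)"
    using 1 norm_triangle_sub[of "f z" "f 0"] by linarith
  also have "\<dots> = N * (\<alpha> / (\<alpha> - 1)) * (1 - r) powr (1 - \<alpha>)"
    using \<alpha> by (simp add: field_simps)
  finally show ?thesis by (simp add: N_def r_def)
qed

lemma deriv_div_one_minus:
  assumes f: "f holomorphic_on ball 0 1" and w: "cmod w < 1"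
  shows "deriv (\<lambda>w. f w / (1 - w)) w = deriv f w / (1 - w) + f w / (1 - w)\<^sup>2"
proof -
  have "(f has_field_derivative deriv f w) (at w)"
    using f w by (intro holomorphic_derivI[of _ "ball 0 1"]) auto
  moreover have "1 - w \<noteq> 0" using w by auto
  moreover have "((\<lambda>w. 1 - w) has_field_derivative - 1) (at w)"
    by (auto intro!: derivative_eq_intros)
  ultimately have "deriv (\<lambda>w. f w / (1 - w)) w = (deriv f w * (1 - w) + f w) / ((1 - w) * (1 - w))"
    using DERIV_imp_deriv[OF DERIV_divide] by fastforce
  then show ?thesis
    using \<open>1 - w \<noteq> 0\<close> by (simp add: add_divide_distrib power2_eq_square)
qed

lemma cmod_deriv_div_one_minus_le:
  assumes f: "f holomorphic_on ball 0 1" and w: "cmod w < 1"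
  shows "cmod (deriv (\<lambda>w. f w / (1 - w)) w) \<le> cmod (deriv f w) / (1 - cmod w) + cmod (f w) / (1 - cmod w)\<^sup>2"
proof -
  have le: "1 - cmod w \<le> cmod (1 - w)"
    using norm_triangle_ineq2[of 1 w] by simp
  have "cmod (deriv (\<lambda>w. f w / (1 - w)) w) \<le> cmod (deriv f w) / cmod (1 - w) + cmod (f w) / (cmod (1 - w))\<^sup>2"
    unfolding deriv_div_one_minus[OF assms]
    using norm_triangle_ineq[of "deriv f w / (1 - w)" "f w / (1 - w)\<^sup>2"] by (simp add: norm_divide norm_power)
  also have "\<dots> \<le> cmod (deriv f w) / (1 - cmod w) + cmod (f w) / (1 - cmod w)\<^sup>2"
    using le w by (intro add_mono divide_left_mono power_mono mult_pos_pos zero_less_power) auto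
  finally show ?thesis .
qed

text \<open>Cauchy's inequality on a circle of radius x / 2; the factor x / 2 in the hypothesis
  cancels the loss in that inequality.\<close>

lemma cmod_deriv_le_of_larger_disc:
  assumes f: "f holomorphic_on ball 0 1" and x: "0 < x"
    and le: "\<And>w. cmod w \<le> 1 - x / 2 \<Longrightarrow> cmod (f w) \<le> \<eta> * (x / 2)"
    and w: "cmod w \<le> 1 - x"
  shows "cmod (deriv f w) \<le> \<eta>"
proof -
  have sub: "cmod v \<le> 1 - x / 2" if "v \<in> cball w (x / 2)" for v
    using that w norm_triangle_sub[of v w] by (simp add: dist_norm norm_minus_commute)
  then have "cball w (x / 2) \<subseteq> ball 0 1"
    using x by fastforce
  then have "f holomorphic_on cball w (x / 2)"
    using f holomorphic_on_subset by blast
  then have "cmod ((deriv ^^ 1) f w) \<le> fact 1 * (\<eta> * (x / 2)) / (x / 2) ^ 1"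
    using x sub le
    by (intro Cauchy_inequality) (auto intro: holomorphic_on_imp_continuous_on
      holomorphic_on_subset[OF _ ball_subset_cball] simp: dist_norm)
  then show ?thesis using x by simp
qed

section \<open>The weighted derivative of the image\<close>

context radial_measure
begin

text \<open>The integral is split at t = 1 - x0. Below it, tz stays in the compact disc where \<eta>
  bounds f and f'; above it, the growth bounds apply with 1 - |tz| \<ge> max (1 - t) (1 - |z|), and
  the dyadic estimate finishes. Free \<epsilon> and \<eta> let the lemma yield both boundedness
  (crude values) and compactness (small values).\<close>

lemma bloch_weight_cesaro_op_le:
  assumes f: "f holomorphic_on ball 0 1" and K: "0 \<le> K"
    and f_le: "\<And>w. cmod w < 1 \<Longrightarrow> cmod (f w) \<le> K * (1 - cmod w) powr (1 - \<alpha>)"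
    and df_le: "\<And>w. cmod w < 1 \<Longrightarrow> cmod (deriv f w) \<le> K * (1 - cmod w) powr - \<alpha>"
    and x0: "0 < x0" "x0 \<le> 1"
    and \<eta>: "\<And>w. cmod w \<le> 1 - x0 \<Longrightarrow> cmod (f w) \<le> \<eta>" "\<And>w. cmod w \<le> 1 - x0 \<Longrightarrow> cmod (deriv f w) \<le> \<eta>"
    and \<alpha>: "0 < \<alpha>" and \<beta>: "0 < \<beta>" "\<beta> < \<alpha> + 1" and \<epsilon>: "0 \<le> \<epsilon>"
    and m: "\<And>x. 0 < x \<Longrightarrow> x \<le> x0 \<Longrightarrow> measure \<mu> {1 - x..<1} \<le> \<epsilon> * x powr (\<alpha> + 1 - \<beta>)"
    and z: "cmod z < 1"
  shows "bloch_weight \<beta> (cesaro_op \<mu> f) z \<le>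
    2 * \<eta> / x0\<^sup>2 * measure \<mu> (space \<mu>)
    + 2 powr \<beta> * 2 * K * (\<epsilon> * (2 powr (\<alpha> + 1 - \<beta>) / (1 - 2 powr - \<beta>)))"
proof -
  define g where "g = (\<lambda>w. f w / (1 - w))"
  define d where "d = 1 - cmod z"
  define C where "C = 2 powr (\<alpha> + 1 - \<beta>) / (1 - 2 powr - \<beta>)"
  have d: "0 < d" "d \<le> 1" using z by (auto simp: d_def)
  have \<eta>0: "0 \<le> \<eta>" using order_trans[OF norm_ge_zero \<eta>(1)[of 0]] x0 by simp
  define \<Phi> where "\<Phi> t = 2 * \<eta> / x0\<^sup>2 + 2 * K * (indicator {1 - x0..<1} t * max (1 - t) d powr - (\<alpha> + 1))" for t
  have int1: "integrable \<mu> (\<lambda>t. indicator {1 - x0..<1} t * max (1 - t) d powr - (\<alpha> + 1))"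
  proof (rule integrable_const_bound[of _ "d powr - (\<alpha> + 1)"])
    have "(\<lambda>t. max (1 - t) d powr - (\<alpha> + 1)) \<in> borel_measurable \<mu>"
      using d by (intro borel_measurable_radial continuous_intros) auto
    moreover have "{1 - x0..<1} \<in> sets \<mu>" using x0 by simp
    ultimately show "(\<lambda>t. indicator {1 - x0..<1} t * max (1 - t) d powr - (\<alpha> + 1)) \<in> borel_measurable \<mu>"
      by measurable
    show "AE t in \<mu>. norm (indicator {1 - x0..<1} t * max (1 - t) d powr - (\<alpha> + 1)) \<le> d powr - (\<alpha> + 1)"
      using d \<alpha> by (intro AE_I2) (auto simp: indicator_def intro!: powr_mono2')
  qed
  have pw: "norm (of_real t * deriv g (of_real t * z)) \<le> \<Phi> t" if "t \<in> space \<mu>" for t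
  proof -
    have t: "0 \<le> t" "t < 1" using that by (auto simp: space_radial)
    define w where "w = of_real t * z"
    have wz: "cmod w \<le> cmod z" and wt: "cmod w \<le> t"
      using t z by (auto simp: w_def norm_mult mult_left_le_one_le mult_left_le)
    have w1: "cmod w < 1" using wz z by simp
    have "norm (of_real t * deriv g w) \<le> norm (deriv g w)"
      using t by (simp add: norm_mult mult_left_le_one_le)
    also have "\<dots> \<le> cmod (deriv f w) / (1 - cmod w) + cmod (f w) / (1 - cmod w)\<^sup>2"
      unfolding g_def by (rule cmod_deriv_div_one_minus_le[OF f w1])
    also have "\<dots> \<le> \<Phi> t"
    proof (cases "t \<in> {1 - x0..<1}")
      case True
      have "cmod (deriv f w) / (1 - cmod w) + cmod (f w) / (1 - cmod w)\<^sup>2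
          \<le> K * (1 - cmod w) powr - \<alpha> / (1 - cmod w) + K * (1 - cmod w) powr (1 - \<alpha>) / (1 - cmod w)\<^sup>2"
        using w1 by (intro add_mono divide_right_mono f_le df_le) auto
      also have "\<dots> = 2 * K * (1 - cmod w) powr - (\<alpha> + 1)"
      proof -
        have "(1 - cmod w) powr - \<alpha> / (1 - cmod w) = (1 - cmod w) powr - (\<alpha> + 1)"
          using w1 powr_diff[of "1 - cmod w" "- \<alpha>" 1] by simp
        moreover have "(1 - cmod w) powr (1 - \<alpha>) / (1 - cmod w)\<^sup>2 = (1 - cmod w) powr - (\<alpha> + 1)"
        proof -
          have "- (\<alpha> + 1) = 1 - \<alpha> - 2" by simp
          then show ?thesis
            using w1 by (simp only: powr_diff) (simp add: powr_numeral)
        qed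
        ultimately show ?thesis
          by (simp flip: times_divide_eq_right)
      qed
      also have "\<dots> \<le> 2 * K * max (1 - t) d powr - (\<alpha> + 1)"
        using K \<alpha> wz wt d by (intro mult_left_mono powr_mono2') (auto simp: d_def)
      also have "\<dots> \<le> \<Phi> t"
        using True \<eta>0 by (simp add: \<Phi>_def)
      finally show ?thesis .
    next
      case False
      then have "cmod w \<le> 1 - x0" using t wt by auto
      then have le: "cmod (f w) \<le> \<eta>" "cmod (deriv f w) \<le> \<eta>" "x0 \<le> 1 - cmod w"
        using \<eta> by auto
      have "cmod (deriv f w) / (1 - cmod w) + cmod (f w) / (1 - cmod w)\<^sup>2 \<le> \<eta> / x0\<^sup>2 + \<eta> / x0\<^sup>2"
      proof (intro add_mono frac_le)
        \<comment> \<open>As x0 \<le> 1, the squared denominator serves both summands.\<close>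
        show "x0\<^sup>2 \<le> 1 - cmod w"
          using power_decreasing[of 1 2 x0] le x0 by simp
        show "x0\<^sup>2 \<le> (1 - cmod w)\<^sup>2"
          using le x0 by (intro power_mono) auto
      qed (use le \<eta>0 x0 in auto)
      also have "\<dots> \<le> \<Phi> t" using False by (simp add: \<Phi>_def)
      finally show ?thesis .
    qed
    finally show ?thesis by (simp add: w_def)
  qed
  have "cmod (deriv (cesaro_op \<mu> f) z) = cmod (\<integral>t. of_real t * deriv g (of_real t * z) \<partial>\<mu>)"
    using DERIV_imp_deriv[OF has_field_derivative_cesaro_op[OF f z]] by (simp add: g_def)
  also have "\<dots> \<le> (\<integral>t. norm (of_real t * deriv g (of_real t * z)) \<partial>\<mu>)"
    by (rule integral_norm_bound)
  also have "\<dots> \<le> (\<integral>t. \<Phi> t \<partial>\<mu>)"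
  proof (rule integral_mono')
    show "integrable \<mu> \<Phi>" unfolding \<Phi>_def using int1 by auto
  qed (use pw order_trans[OF norm_ge_zero pw] in auto)
  also have "\<dots> = 2 * \<eta> / x0\<^sup>2 * measure \<mu> (space \<mu>)
      + 2 * K * (\<integral>t. indicator {1 - x0..<1} t * max (1 - t) d powr - (\<alpha> + 1) \<partial>\<mu>)"
    unfolding \<Phi>_def using int1 by (subst Bochner_Integration.integral_add) auto
  \<comment> \<open>The dyadic estimate is used with s = \<alpha> + 1 - \<beta>, so that s + \<beta>
    is the exponent \<alpha> + 1 and s > 0 is the hypothesis \<beta> < \<alpha> + 1.\<close>
  also have "\<dots> \<le> 2 * \<eta> / x0\<^sup>2 * measure \<mu> (space \<mu>) + 2 * K * (\<epsilon> * C * d powr - \<beta>)"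
    using integral_max_powr_le[of "\<alpha> + 1 - \<beta>" \<beta> \<epsilon> x0 d] \<beta> \<epsilon> x0 d m K
    by (intro add_left_mono mult_left_mono) (auto simp: C_def algebra_simps)
  finally have le: "cmod (deriv (cesaro_op \<mu> f) z)
      \<le> 2 * \<eta> / x0\<^sup>2 * measure \<mu> (space \<mu>) + 2 * K * (\<epsilon> * C * d powr - \<beta>)" .
  \<comment> \<open>The weight enters twice: W \<le> 1 suffices for the \<eta> term, and W \<le> (2
    d) powr \<beta> cancels the factor d powr -\<beta> of the other.\<close>
  define W where "W = (1 - (cmod z)\<^sup>2) powr \<beta>"
  have "(cmod z)\<^sup>2 \<le> 1" using z by (simp add: power_le_one)
  have "W \<le> 1 powr \<beta>"
    unfolding W_def using \<beta> \<open>(cmod z)\<^sup>2 \<le> 1\<close> by (intro powr_mono2) auto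
  then have W1: "W \<le> 1" by simp
  have "1 - (cmod z)\<^sup>2 = d * (1 + cmod z)"
    by (simp add: d_def power2_eq_square algebra_simps)
  also have "\<dots> \<le> 2 * d"
    using z d by simp
  finally have "W \<le> (2 * d) powr \<beta>"
    unfolding W_def using \<beta> \<open>(cmod z)\<^sup>2 \<le> 1\<close> by (intro powr_mono2) auto
  then have W2: "W * d powr - \<beta> \<le> 2 powr \<beta>"
    using d by (simp add: powr_mult powr_minus field_simps)
  have C0: "0 \<le> C"
    using powr_mono[of "- \<beta>" 0 2] \<beta> by (simp add: C_def)
  have W0: "0 \<le> W" by (simp add: W_def)
  have "bloch_weight \<beta> (cesaro_op \<mu> f) z \<le> W * (2 * \<eta> / x0\<^sup>2 * measure \<mu> (space \<mu>) + 2 * K * (\<epsilon> * C * d powr - \<beta>))"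
    unfolding bloch_weight_def W_def[symmetric] using le W0 by (rule mult_left_mono)
  also have "\<dots> = W * (2 * \<eta> / x0\<^sup>2 * measure \<mu> (space \<mu>)) + (W * d powr - \<beta>) * (2 * K * (\<epsilon> * C))"
    by (simp add: algebra_simps)
  also have "\<dots> \<le> 2 * \<eta> / x0\<^sup>2 * measure \<mu> (space \<mu>) + 2 powr \<beta> * (2 * K * (\<epsilon> * C))"
    using W1 W2 W0 C0 K \<epsilon> \<eta>0 by (intro add_mono mult_right_mono mult_left_le_one_le) auto
  finally show ?thesis by (simp add: C_def)
qed

end

section \<open>Compactness for vanishing Carleson measures\<close>

text \<open>Relative compactness in sequential form, by Bolzano-Weierstrass; the limit may lie
  outside \<open>S\<close>. On the carrier the metric is the norm of the difference, so metric
  limits are norm limits.\<close>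

lemma compactin_closure_Bloch_iff:
  assumes S: "S \<subseteq> Bloch \<beta>"
  shows "compactin (Bloch_topology \<beta>) (Bloch_topology \<beta> closure_of S) \<longleftrightarrow>
    (\<forall>\<sigma>::nat \<Rightarrow> complex \<Rightarrow> complex. range \<sigma> \<subseteq> S \<longrightarrow>
      (\<exists>l r. l \<in> Bloch \<beta> \<and> strict_mono r \<and> (\<lambda>n. bloch_norm \<beta> (\<lambda>z. \<sigma> (r n) z - l z)) \<longlonglongrightarrow> 0))"
  (is "?L \<longleftrightarrow> ?R")
proof -
  interpret M: Metric_space "Bloch \<beta>" "bloch_dist \<beta>" by (rule Metric_space_Bloch)
  have lim: "limitin M.mtopology (\<sigma> \<circ> r) l sequentially \<longleftrightarrow>
      l \<in> Bloch \<beta> \<and> (\<lambda>n. bloch_norm \<beta> (\<lambda>z. \<sigma> (r n) z - l z)) \<longlonglongrightarrow> 0"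
    if "range \<sigma> \<subseteq> S" for \<sigma> l and r :: "nat \<Rightarrow> nat"
  proof -
    have "\<sigma> n \<in> Bloch \<beta>" for n using that S by auto
    then show ?thesis
      by (auto simp: M.limitin_metric_dist_null bloch_dist_def)
  qed
  have "?L \<longleftrightarrow> (\<forall>T. T \<subseteq> S \<and> infinite T \<longrightarrow> Bloch \<beta> \<inter> M.mtopology derived_set_of T \<noteq> {})"
    unfolding Bloch_topology_def M.compact_closure_of_eq_Bolzano_Weierstrass
    using S derived_set_of_subset_topspace[of M.mtopology] by (simp add: Int_absorb1 conj_commute) blast
  also have "\<dots> \<longleftrightarrow> (\<forall>\<sigma>::nat \<Rightarrow> complex \<Rightarrow> complex. range \<sigma> \<subseteq> S \<longrightarrow>
      (\<exists>l r. l \<in> Bloch \<beta> \<and> strict_mono r \<and> limitin M.mtopology (\<sigma> \<circ> r) l sequentially))"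
    by (rule M.Bolzano_Weierstrass_property[OF S S, symmetric])
  also have "\<dots> \<longleftrightarrow> ?R"
    by (simp add: lim cong: imp_cong conj_cong)
  finally show ?thesis .
qed

text \<open>The growth estimate makes the sequence locally uniformly bounded, so Montel's theorem
  applies. Derivatives converge too, so the weight bound \<open>B\<close> passes to the limit
  pointwise; adding the separate bound \<open>B\<close> for |h(0)| gives 2 B.\<close>

lemma bounded_Bloch_subsequence:
  assumes \<alpha>: "1 < \<alpha>" and f: "\<And>n::nat. f n \<in> Bloch \<alpha>" and B: "\<And>n. bloch_norm \<alpha> (f n) \<le> B"
  obtains h r where "h \<in> Bloch \<alpha>" "bloch_norm \<alpha> h \<le> 2 * B" "strict_mono (r :: nat \<Rightarrow> nat)"
    "\<And>K. compact K \<Longrightarrow> K \<subseteq> ball 0 1 \<Longrightarrow> uniform_limit K (\<lambda>n. f (r n)) h sequentially"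
proof -
  have bnd: "\<exists>C. \<forall>g\<in>range f. \<forall>z\<in>K. norm (g z) \<le> C" if K: "compact K" "K \<subseteq> ball 0 1" for K
  proof -
    let ?\<phi> = "\<lambda>z::complex. B * (\<alpha> / (\<alpha> - 1)) * (1 - cmod z) powr (1 - \<alpha>)"
    have "continuous_on K ?\<phi>"
      using K by (intro continuous_intros) auto
    then have "bounded (?\<phi> ` K)"
      by (intro compact_imp_bounded compact_continuous_image K)
    then obtain C where C: "\<And>z. z \<in> K \<Longrightarrow> norm (?\<phi> z) \<le> C"
      by (auto simp: bounded_iff)
    have "cmod (f n z) \<le> C" if z: "z \<in> K" for n z
    proof -
      have "cmod (f n z) \<le> bloch_norm \<alpha> (f n) * (\<alpha> / (\<alpha> - 1)) * (1 - cmod z) powr (1 - \<alpha>)"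
        using z K by (intro cmod_le_bloch_norm \<alpha> f) auto
      also have "\<dots> \<le> ?\<phi> z"
        using \<alpha> by (intro mult_right_mono B) auto
      also have "\<dots> \<le> C" using C[OF z] unfolding real_norm_def by (rule abs_le_D1)
      finally show ?thesis .
    qed
    then show ?thesis by blast
  qed
  obtain g r where g: "g holomorphic_on ball 0 1" and r: "strict_mono (r :: nat \<Rightarrow> nat)"
    and ul: "\<And>K. compact K \<Longrightarrow> K \<subseteq> ball 0 1 \<Longrightarrow> uniform_limit K (f \<circ> r) g sequentially"
  proof (rule Montel[OF open_ball, of "range f" 0 1 f])
    show "h holomorphic_on ball 0 1" if "h \<in> range f" for h
      using that Bloch_holomorphic[OF f] by blast
  qed (use bnd in blast)+
  \<comment> \<open>The values of Montel's limit off the disc are uncontrolled, while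
    \<open>hol_disc\<close> demands zero there.\<close>
  define h where "h z = (if z \<in> ball 0 1 then g z else 0)" for z
  have hol: "h holomorphic_on ball 0 1"
    using g by (rule holomorphic_transform) (simp add: h_def)
  have ulh: "uniform_limit K (\<lambda>n. f (r n)) h sequentially" if K: "compact K" "K \<subseteq> ball 0 1" for K
    using ul[OF K] K by (subst uniform_limit_cong'[where g = "f \<circ> r" and i = g]) (auto simp: h_def)
  have lim0: "(\<lambda>n. f (r n) 0) \<longlonglongrightarrow> h 0"
    by (rule tendsto_uniform_limitI[OF ulh[of "{0}"]]) auto
  have w: "bloch_weight \<alpha> h z \<le> B" if z: "cmod z < 1" for z
  proof -
    obtain e where e: "0 < e" "cball z e \<subseteq> ball 0 1"
      using z open_contains_cball[of "ball 0 1"] by (meson mem_ball_0 open_ball)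
    have "uniform_limit (ball z e) (\<lambda>n. f (r n)) h sequentially"
      using uniform_limit_on_subset[OF ulh[OF compact_cball e(2)] ball_subset_cball] .
    then have "(\<lambda>n. deriv (f (r n)) z) \<longlonglongrightarrow> deriv h z"
    proof (rule deriv_complex_uniform_limit)
      have "ball z e \<subseteq> ball 0 1" using e ball_subset_cball by blast
      then show "\<forall>\<^sub>F n in sequentially. f (r n) holomorphic_on ball z e"
        using holomorphic_on_subset[OF Bloch_holomorphic[OF f]] by simp
    qed (use e in auto)
    then have "(\<lambda>n. bloch_weight \<alpha> (f (r n)) z) \<longlonglongrightarrow> bloch_weight \<alpha> h z"
      unfolding bloch_weight_def by (intro tendsto_intros)
    then show ?thesis
      using order_trans[OF bloch_weight_le_norm[OF f z] B] by (intro LIMSEQ_le_const2) auto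
  qed
  have "h \<in> Bloch \<alpha>"
    using hol w by (intro BlochI) (auto simp: hol_disc_def h_def)
  moreover have "cmod (h 0) \<le> B"
    using tendsto_norm[OF lim0] order_trans[OF norm_at_0_le_bloch_norm[OF f] B]
    by (intro LIMSEQ_le_const2) auto
  then have "bloch_norm \<alpha> h \<le> 2 * B"
    using bloch_norm_le[of \<alpha> h B] w by fastforce
  ultimately show ?thesis
    using that r ulh by blast
qed

section \<open>Boundedness, null sequences and compactness under the Carleson condition\<close>

context radial_measure
begin

text \<open>The weight estimate is applied with \<epsilon> = 1 and with \<eta> = K x0 powr
  -\<alpha>, the value that the growth bounds give on the disc |w| \<le> 1 - x0.\<close>

lemma cesaro_op_Bloch:
  assumes \<alpha>: "1 < \<alpha>" and \<beta>: "0 < \<beta>" "\<beta> < \<alpha> + 1"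
    and v: "vanishing_carleson (\<alpha> + 1 - \<beta>) (disc_measure \<mu>)" and f: "f \<in> Bloch \<alpha>"
  shows "cesaro_op \<mu> f \<in> Bloch \<beta>"
proof -
  obtain x0 where x0: "0 < x0" "x0 \<le> 1"
    and m: "\<And>x. 0 < x \<Longrightarrow> x \<le> x0 \<Longrightarrow> measure \<mu> {1 - x..<1} \<le> 1 * x powr (\<alpha> + 1 - \<beta>)"
    using v unfolding vanishing_carleson_disc_measure_iff by (metis zero_less_one)
  define K where "K = bloch_norm \<alpha> f * (\<alpha> / (\<alpha> - 1))"
  have N: "0 \<le> bloch_norm \<alpha> f" using f by (rule bloch_norm_nonneg)
  have K: "bloch_norm \<alpha> f \<le> K" "0 \<le> K"
    using N \<alpha> mult_left_mono[of 1 "\<alpha> / (\<alpha> - 1)" "bloch_norm \<alpha> f"] by (auto simp: K_def)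
  have f_le: "cmod (f w) \<le> K * (1 - cmod w) powr (1 - \<alpha>)" if "cmod w < 1" for w
    using cmod_le_bloch_norm[OF \<alpha> f that] by (simp add: K_def)
  have df_le: "cmod (deriv f w) \<le> K * (1 - cmod w) powr - \<alpha>" if "cmod w < 1" for w
    using cmod_deriv_le_bloch_norm[OF _ f that] \<alpha> mult_right_mono[OF K(1), of "(1 - cmod w) powr - \<alpha>"] by force
  have p: "(1 - cmod w) powr - a \<le> x0 powr - \<alpha>" if "cmod w \<le> 1 - x0" "0 \<le> a" "a \<le> \<alpha>" for w a
  proof -
    have "(1 - cmod w) powr - a \<le> x0 powr - a"
      using that x0 by (intro powr_mono2') auto
    also have "\<dots> \<le> x0 powr - \<alpha>"
      using that x0 by (intro powr_mono') auto
    finally show ?thesis .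
  qed
  show ?thesis
  proof (rule BlochI)
    show "cesaro_op \<mu> f \<in> hol_disc"
      using f by (intro cesaro_op_in_hol_disc) (simp add: Bloch_def)
    fix z assume "cmod z < 1"
    then show "bloch_weight \<beta> (cesaro_op \<mu> f) z \<le>
      2 * (K * x0 powr - \<alpha>) / x0\<^sup>2 * measure \<mu> (space \<mu>)
      + 2 powr \<beta> * 2 * K * (1 * (2 powr (\<alpha> + 1 - \<beta>) / (1 - 2 powr - \<beta>)))"
    proof (intro bloch_weight_cesaro_op_le Bloch_holomorphic[OF f])
      fix w assume w: "cmod w \<le> 1 - x0"
      then have w1: "cmod w < 1" using x0 by simp
      show "cmod (f w) \<le> K * x0 powr - \<alpha>"
        using f_le[OF w1] mult_left_mono[OF p[OF w, of "\<alpha> - 1"] K(2)] \<alpha> by simp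
      show "cmod (deriv f w) \<le> K * x0 powr - \<alpha>"
        using df_le[OF w1] mult_left_mono[OF p[OF w, of \<alpha>] K(2)] \<alpha> by simp
    qed (use \<alpha> \<beta> K x0 m f_le df_le in auto)
  qed
qed

text \<open>The order of choices matters: \<epsilon> makes the part near t = 1 small uniformly in n
  and fixes \<open>x0\<close>; then \<eta>, which may depend on \<open>x0\<close>, makes the
  remaining part small; finally n is taken large by local uniform convergence.\<close>

lemma bloch_norm_cesaro_op_tendsto_0:
  assumes \<alpha>: "1 < \<alpha>" and \<beta>: "0 < \<beta>" "\<beta> < \<alpha> + 1"
    and v: "vanishing_carleson (\<alpha> + 1 - \<beta>) (disc_measure \<mu>)"
    and f: "\<And>n::nat. f n \<in> Bloch \<alpha>" and B: "\<And>n. bloch_norm \<alpha> (f n) \<le> B"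
    and lim: "\<And>K. compact K \<Longrightarrow> K \<subseteq> ball 0 1 \<Longrightarrow> uniform_limit K f (\<lambda>_. 0) sequentially"
  shows "(\<lambda>n. bloch_norm \<beta> (cesaro_op \<mu> (f n))) \<longlonglongrightarrow> 0"
proof (rule LIMSEQ_I)
  fix e :: real assume e: "0 < e"
  define M where "M = measure \<mu> (space \<mu>)"
  define K where "K = B * (\<alpha> / (\<alpha> - 1))"
  have B0: "0 \<le> B" using bloch_norm_nonneg[OF f] B order_trans by blast
  have K: "B \<le> K" "0 \<le> K"
    using B0 \<alpha> mult_left_mono[of 1 "\<alpha> / (\<alpha> - 1)" B] by (auto simp: K_def)
  define C where "C = 2 powr \<beta> * 2 * K * (2 powr (\<alpha> + 1 - \<beta>) / (1 - 2 powr - \<beta>))"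
  have C0: "0 \<le> C"
    using powr_mono[of "- \<beta>" 0 2] \<beta> K by (simp add: C_def)
  \<comment> \<open>The added 1 keeps the quotient meaningful when C = 0; the same device is used
    for \<eta>.\<close>
  define \<epsilon> where "\<epsilon> = e / (4 * (C + 1))"
  have \<epsilon>: "0 < \<epsilon>" and C\<epsilon>: "C * \<epsilon> \<le> e / 4" using e C0 by (auto simp: \<epsilon>_def field_simps)
  obtain x0 where x0: "0 < x0" "x0 \<le> 1"
    and m: "\<And>x. 0 < x \<Longrightarrow> x \<le> x0 \<Longrightarrow> measure \<mu> {1 - x..<1} \<le> \<epsilon> * x powr (\<alpha> + 1 - \<beta>)"
    using v \<epsilon> unfolding vanishing_carleson_disc_measure_iff by metis
  \<comment> \<open>The summand 1 accounts for the value of the image at 0, the other for the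
    compact part of the integral.\<close>
  define D where "D = (1 + 2 / x0\<^sup>2) * M"
  have D0: "0 \<le> D" using x0 by (simp add: D_def M_def)
  define \<eta> where "\<eta> = e / (4 * (D + 1))"
  have \<eta>: "0 < \<eta>" and D\<eta>: "D * \<eta> \<le> e / 4" using e D0 by (auto simp: \<eta>_def field_simps)
  \<comment> \<open>The margin x0 / 2 beyond the disc |w| \<le> 1 - x0 is what Cauchy's estimate for
    the derivatives needs.\<close>
  have ul: "uniform_limit (cball 0 (1 - x0 / 2)) f (\<lambda>_. 0) sequentially"
    using x0 by (intro lim) auto
  obtain n0 where n0: "\<And>n w. n \<ge> n0 \<Longrightarrow> cmod w \<le> 1 - x0 / 2 \<Longrightarrow> cmod (f n w) < \<eta> * (x0 / 2)"
    using \<eta> x0 uniform_limitD[OF ul, of "\<eta> * (x0 / 2)"]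
    by (fastforce simp: eventually_sequentially)
  have "bloch_norm \<beta> (cesaro_op \<mu> (f n)) < e" if n: "n \<ge> n0" for n
  proof -
    have f\<eta>: "cmod (f n w) \<le> \<eta>" if "cmod w \<le> 1 - x0" for w
    proof -
      have "\<eta> * (x0 / 2) \<le> \<eta>" using \<eta> x0 by simp
      then show ?thesis using n0[OF n, of w] that x0 by linarith
    qed
    have df\<eta>: "cmod (deriv (f n) w) \<le> \<eta>" if "cmod w \<le> 1 - x0" for w
      using n0[OF n] by (intro cmod_deriv_le_of_larger_disc[OF Bloch_holomorphic[OF f] x0(1) _ that]) (simp add: less_imp_le)
    have "bloch_weight \<beta> (cesaro_op \<mu> (f n)) z \<le> 2 * \<eta> / x0\<^sup>2 * M + C * \<epsilon>" if z: "cmod z < 1" for z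
    proof -
      have "bloch_weight \<beta> (cesaro_op \<mu> (f n)) z \<le>
        2 * \<eta> / x0\<^sup>2 * measure \<mu> (space \<mu>)
        + 2 powr \<beta> * 2 * K * (\<epsilon> * (2 powr (\<alpha> + 1 - \<beta>) / (1 - 2 powr - \<beta>)))"
      proof (intro bloch_weight_cesaro_op_le Bloch_holomorphic[OF f])
        fix w assume w: "cmod w < 1"
        show "cmod (f n w) \<le> K * (1 - cmod w) powr (1 - \<alpha>)"
          unfolding K_def using B \<alpha>
          by (intro order_trans[OF cmod_le_bloch_norm[OF \<alpha> f w]] mult_right_mono) auto
        show "cmod (deriv (f n) w) \<le> K * (1 - cmod w) powr - \<alpha>"
          using order_trans[OF B K(1)] \<alpha>
          by (intro order_trans[OF cmod_deriv_le_bloch_norm[OF _ f w]] mult_right_mono) auto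
      qed (use \<alpha> \<beta> K x0 m f\<eta> df\<eta> \<epsilon> z in auto)
      then show ?thesis by (simp add: M_def C_def mult_ac)
    qed
    then have "bloch_norm \<beta> (cesaro_op \<mu> (f n)) \<le> cmod (cesaro_op \<mu> (f n) 0) + (2 * \<eta> / x0\<^sup>2 * M + C * \<epsilon>)"
      by (rule bloch_norm_le)
    also have "cmod (cesaro_op \<mu> (f n) 0) \<le> M * \<eta>"
      using f\<eta>[of 0] x0 by (auto simp: cesaro_op_at_0 norm_mult M_def intro!: mult_left_mono)
    also have "M * \<eta> + (2 * \<eta> / x0\<^sup>2 * M + C * \<epsilon>) = D * \<eta> + C * \<epsilon>"
      by (simp add: D_def algebra_simps)
    also have "\<dots> < e" using D\<eta> C\<epsilon> e by simp
    finally show ?thesis by simp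
  qed
  then show "\<exists>n0. \<forall>n\<ge>n0. norm (bloch_norm \<beta> (cesaro_op \<mu> (f n)) - 0) < e"
    using bloch_norm_nonneg[OF cesaro_op_Bloch[OF \<alpha> \<beta> v f]] by (intro exI[of _ n0]) auto
qed

text \<open>After Montel extraction the differences f_(r n) - h are bounded by 3 B and tend to 0
  locally uniformly, so their images are null; by linearity the images then converge to the image of
  h.\<close>

lemma compact_cesaro_op:
  assumes \<alpha>: "1 < \<alpha>" and \<beta>: "0 < \<beta>" "\<beta> < \<alpha> + 1"
    and v: "vanishing_carleson (\<alpha> + 1 - \<beta>) (disc_measure \<mu>)"
  shows "compact_Bloch_operator \<alpha> \<beta> (cesaro_op \<mu>)"
  unfolding compact_Bloch_operator_def
proof (intro conjI allI impI)
  show sub: "cesaro_op \<mu> ` Bloch \<alpha> \<subseteq> Bloch \<beta>"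
    using cesaro_op_Bloch[OF assms] by blast
  fix S B assume S: "S \<subseteq> Bloch \<alpha> \<and> (\<forall>f\<in>S. bloch_norm \<alpha> f \<le> B)"
  have TS: "cesaro_op \<mu> ` S \<subseteq> Bloch \<beta>" using S sub by blast
  show "compactin (Bloch_topology \<beta>) (Bloch_topology \<beta> closure_of cesaro_op \<mu> ` S)"
    unfolding compactin_closure_Bloch_iff[OF TS]
  proof (intro allI impI)
    fix \<sigma> :: "nat \<Rightarrow> complex \<Rightarrow> complex" assume \<sigma>: "range \<sigma> \<subseteq> cesaro_op \<mu> ` S"
    then have "\<forall>n. \<exists>f\<in>S. \<sigma> n = cesaro_op \<mu> f" by blast
    then obtain f where f: "\<And>n. f n \<in> S" "\<And>n. \<sigma> n = cesaro_op \<mu> (f n)" by metis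
    have fB: "f n \<in> Bloch \<alpha>" "bloch_norm \<alpha> (f n) \<le> B" for n using f S by auto
    obtain h r where h: "h \<in> Bloch \<alpha>" "bloch_norm \<alpha> h \<le> 2 * B" and r: "strict_mono (r :: nat \<Rightarrow> nat)"
      and ul: "\<And>K. compact K \<Longrightarrow> K \<subseteq> ball 0 1 \<Longrightarrow> uniform_limit K (\<lambda>n. f (r n)) h sequentially"
      by (rule bounded_Bloch_subsequence[of \<alpha> f B, OF \<alpha> fB]) (rule that)
    have "(\<lambda>n. bloch_norm \<beta> (cesaro_op \<mu> (\<lambda>z. f (r n) z - h z))) \<longlonglongrightarrow> 0"
    proof (rule bloch_norm_cesaro_op_tendsto_0[OF assms])
      show "(\<lambda>z. f (r n) z - h z) \<in> Bloch \<alpha>" for n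
        using fB h by (intro Bloch_diff)
      show "bloch_norm \<alpha> (\<lambda>z. f (r n) z - h z) \<le> B + 2 * B" for n
        using bloch_norm_diff_le[OF fB(1)[of "r n"] h(1)] fB(2)[of "r n"] h(2) by linarith
      show "uniform_limit K (\<lambda>n z. f (r n) z - h z) (\<lambda>_. 0) sequentially"
        if "compact K" "K \<subseteq> ball 0 1" for K
        using ul[OF that] by (simp add: uniform_limit_iff dist_norm)
    qed
    moreover have "cesaro_op \<mu> (\<lambda>z. f (r n) z - h z) = (\<lambda>z. \<sigma> (r n) z - cesaro_op \<mu> h z)" for n
      using fB h f(2) by (simp add: cesaro_op_diff Bloch_def)
    ultimately have "(\<lambda>n. bloch_norm \<beta> (\<lambda>z. \<sigma> (r n) z - cesaro_op \<mu> h z)) \<longlonglongrightarrow> 0"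
      by simp
    then show "\<exists>l r. l \<in> Bloch \<beta> \<and> strict_mono r \<and> (\<lambda>n. bloch_norm \<beta> (\<lambda>z. \<sigma> (r n) z - l z)) \<longlonglongrightarrow> 0"
      using r sub h(1) by blast
  qed
qed

end

section \<open>Test functions and the converse\<close>

text \<open>An integer exponent avoids branches of complex powers. Near 1 the derivative of the
  unnormalised quotient has size d powr -(k + 1); the prefactor brings it down to the Bloch rate d
  powr -\<alpha>.\<close>

definition bloch_test :: "real \<Rightarrow> nat \<Rightarrow> real \<Rightarrow> complex \<Rightarrow> complex" where
  "bloch_test \<alpha> k d z =
    (if z \<in> ball 0 1 then of_real (d powr (real k + 1 - \<alpha>)) / (1 - of_real (1 - d) * z) ^ k else 0)"

lemma one_minus_mult_bounds:
  assumes d: "0 < d" "d < 1" and z: "cmod z < 1"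
  shows "d \<le> cmod (1 - of_real (1 - d) * z)" "1 - cmod z \<le> cmod (1 - of_real (1 - d) * z)"
    "1 - of_real (1 - d) * z \<noteq> 0"
proof -
  have 1: "1 - (1 - d) * cmod z \<le> cmod (1 - of_real (1 - d) * z)"
    using norm_triangle_ineq2[of 1 "of_real (1 - d) * z"] d by (simp add: norm_mult del: of_real_diff)
  have "(1 - d) * cmod z \<le> 1 - d" "(1 - d) * cmod z \<le> cmod z"
    using d z by (auto intro: mult_left_le mult_left_le_one_le)
  then show 2: "d \<le> cmod (1 - of_real (1 - d) * z)" "1 - cmod z \<le> cmod (1 - of_real (1 - d) * z)"
    using 1 by linarith+
  show "1 - of_real (1 - d) * z \<noteq> 0"
    using 2(1) d by auto
qed

lemma has_field_derivative_bloch_test: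
  assumes d: "0 < d" "d < 1" and z: "cmod z < 1"
  shows "(bloch_test \<alpha> k d has_field_derivative
    of_real (d powr (real k + 1 - \<alpha>)) * (of_nat k * of_real (1 - d)) / (1 - of_real (1 - d) * z) ^ Suc k) (at z)"
proof -
  define A where "A = complex_of_real (1 - d)"
  define C where "C = complex_of_real (d powr (real k + 1 - \<alpha>))"
  have nz: "1 - A * z \<noteq> 0" unfolding A_def by (rule one_minus_mult_bounds(3)[OF assms])
  have "((\<lambda>z. (1 - A * z) ^ k) has_field_derivative of_nat k * (1 - A * z) ^ (k - 1) * - A) (at z)"
    by (auto intro!: derivative_eq_intros simp: mult_ac)
  from DERIV_cmult[OF DERIV_inverse_fun[OF this], of C] nz
  have "((\<lambda>z. C * inverse ((1 - A * z) ^ k)) has_field_derivative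
      C * - (inverse ((1 - A * z) ^ k) * (of_nat k * (1 - A * z) ^ (k - 1) * - A) * inverse ((1 - A * z) ^ k))) (at z)"
    by (simp add: mult_ac)
  moreover have eq: "C * - (inverse (u ^ k) * (of_nat k * u ^ (k - 1) * - A) * inverse (u ^ k)) = C * (of_nat k * A) / u ^ Suc k"
    if "u \<noteq> 0" for u
    using that by (cases k) (simp_all add: field_simps)
  ultimately have "((\<lambda>z. C / (1 - A * z) ^ k) has_field_derivative C * (of_nat k * A) / (1 - A * z) ^ Suc k) (at z)"
    by (simp only: divide_inverse[of C, symmetric] eq[OF nz])
  then show ?thesis
    unfolding A_def C_def by (rule has_field_derivative_transform_within_open[of _ _ _ "ball 0 1"])
      (use z in \<open>auto simp: bloch_test_def A_def C_def\<close>)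
qed

lemma bloch_test_in_hol_disc: "0 < d \<Longrightarrow> d < 1 \<Longrightarrow> bloch_test \<alpha> k d \<in> hol_disc"
  using has_field_derivative_bloch_test[of d _ \<alpha> k]
  by (auto simp: hol_disc_def holomorphic_on_open bloch_test_def) (metis)

lemma cmod_deriv_bloch_test_le:
  assumes d: "0 < d" "d < 1" and z: "cmod z < 1"
  shows "cmod (deriv (bloch_test \<alpha> k d) z) \<le>
    d powr (real k + 1 - \<alpha>) * k / cmod (1 - of_real (1 - d) * z) ^ Suc k"
proof -
  have "cmod (deriv (bloch_test \<alpha> k d) z) =
      d powr (real k + 1 - \<alpha>) * (k * (1 - d)) / cmod (1 - of_real (1 - d) * z) ^ Suc k"
    unfolding DERIV_imp_deriv[OF has_field_derivative_bloch_test[OF assms]] norm_divide norm_power norm_mult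
      norm_of_real norm_of_nat
    using d by simp
  also have "\<dots> \<le> d powr (real k + 1 - \<alpha>) * k / cmod (1 - of_real (1 - d) * z) ^ Suc k"
    using d by (intro divide_right_mono mult_left_mono mult_left_le) auto
  finally show ?thesis .
qed

text \<open>With u = |1 - (1 - d) z|, both d \<le> u and 1 - |z|^2 \<le> 2 u, so every factor is
  compared with a power of u and these powers cancel. The condition \<alpha> \<le> k makes the
  exponent k + 1 - \<alpha> positive.\<close>

lemma bloch_test_Bloch:
  assumes \<alpha>: "0 < \<alpha>" "\<alpha> \<le> k" and d: "0 < d" "d < 1"
  shows "bloch_test \<alpha> k d \<in> Bloch \<alpha>" "bloch_norm \<alpha> (bloch_test \<alpha> k d) \<le> 1 + 2 powr \<alpha> * k"
proof -
  have w: "bloch_weight \<alpha> (bloch_test \<alpha> k d) z \<le> 2 powr \<alpha> * k" if z: "cmod z < 1" for z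
  proof -
    define u where "u = cmod (1 - of_real (1 - d) * z)"
    have u: "d \<le> u" "1 - cmod z \<le> u" "0 < u"
      using one_minus_mult_bounds[OF d z] d by (auto simp: u_def)
    have "(cmod z)\<^sup>2 \<le> 1" using z by (simp add: power_le_one)
    have "1 - (cmod z)\<^sup>2 = (1 - cmod z) * (1 + cmod z)"
      by (simp add: power2_eq_square algebra_simps)
    also have "\<dots> \<le> u * 2"
      using z u by (intro mult_mono) auto
    finally have 1: "(1 - (cmod z)\<^sup>2) powr \<alpha> \<le> (u * 2) powr \<alpha>"
      using \<alpha> \<open>(cmod z)\<^sup>2 \<le> 1\<close> by (intro powr_mono2) auto
    have 2: "d powr (real k + 1 - \<alpha>) \<le> u powr (real k + 1 - \<alpha>)"
      using \<alpha> d u by (intro powr_mono2) auto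
    have "bloch_weight \<alpha> (bloch_test \<alpha> k d) z \<le> (u * 2) powr \<alpha> * (u powr (real k + 1 - \<alpha>) * k / u ^ Suc k)"
      unfolding bloch_weight_def
    proof (rule mult_mono[OF 1])
      show "cmod (deriv (bloch_test \<alpha> k d) z) \<le> u powr (real k + 1 - \<alpha>) * k / u ^ Suc k"
        unfolding u_def
        by (intro order_trans[OF cmod_deriv_bloch_test_le[OF d z]] divide_right_mono mult_right_mono 2[unfolded u_def]) auto
    qed auto
    also have "\<dots> = 2 powr \<alpha> * k * (u powr \<alpha> * u powr (real k + 1 - \<alpha>) / u ^ Suc k)"
      using u by (simp add: powr_mult mult_ac)
    also have "u powr \<alpha> * u powr (real k + 1 - \<alpha>) = u ^ Suc k"
      using u powr_realpow[of u "Suc k"] by (simp add: powr_add[symmetric] add_ac)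
    finally show ?thesis using u by simp
  qed
  show "bloch_test \<alpha> k d \<in> Bloch \<alpha>"
    using w by (intro BlochI bloch_test_in_hol_disc d)
  have "d powr (real k + 1 - \<alpha>) \<le> 1 powr (real k + 1 - \<alpha>)"
    using d \<alpha> by (intro powr_mono2) auto
  then have "cmod (bloch_test \<alpha> k d 0) \<le> 1"
    by (simp add: bloch_test_def)
  then show "bloch_norm \<alpha> (bloch_test \<alpha> k d) \<le> 1 + 2 powr \<alpha> * k"
    using bloch_norm_le[of \<alpha> "bloch_test \<alpha> k d", OF w] by linarith
qed

section \<open>Upper and lower bounds for images of the test functions\<close>

context radial_measure
begin

text \<open>For fixed z all denominators are bounded below independently of d, so the image
  derivatives vanish pointwise as d \<rightarrow> 0. This identifies any norm limit of the
  images.\<close>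

lemma cmod_deriv_cesaro_op_bloch_test_le:
  assumes d: "0 < d" "d < 1" and z: "cmod z < 1"
  shows "cmod (deriv (cesaro_op \<mu> (bloch_test \<alpha> k d)) z) \<le>
    d powr (real k + 1 - \<alpha>) * ((real k + 1) / (1 - cmod z) ^ (k + 2) * measure \<mu> (space \<mu>))"
proof -
  let ?f = "bloch_test \<alpha> k d"
  let ?g = "\<lambda>w. ?f w / (1 - w)"
  define p where "p = d powr (real k + 1 - \<alpha>)"
  define \<rho> where "\<rho> = 1 - cmod z"
  have \<rho>: "0 < \<rho>" "\<rho> \<le> 1" and p: "0 \<le> p" using z by (auto simp: \<rho>_def p_def)
  have f: "?f holomorphic_on ball 0 1"
    using bloch_test_in_hol_disc[OF d] by (simp add: hol_disc_def)
  have pw: "cmod (of_real t * deriv ?g (of_real t * z)) \<le> p * ((real k + 1) / \<rho> ^ (k + 2))"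
    if "t \<in> space \<mu>" for t
  proof -
    have t: "0 \<le> t" "t < 1" using that by (auto simp: space_radial)
    define w where "w = of_real t * z"
    have "cmod w \<le> cmod z"
      using t z by (simp add: w_def norm_mult mult_left_le_one_le)
    then have w1: "cmod w < 1" and \<rho>w: "\<rho> \<le> 1 - cmod w"
      using z by (auto simp: \<rho>_def)
    define u where "u = cmod (1 - of_real (1 - d) * w)"
    have u: "\<rho> \<le> u" using one_minus_mult_bounds(2)[OF d w1] \<rho>w by (simp add: u_def)
    have "cmod (of_real t * deriv ?g w) \<le> cmod (deriv ?g w)"
      using t by (simp add: norm_mult mult_left_le_one_le)
    also have "\<dots> \<le> cmod (deriv ?f w) / (1 - cmod w) + cmod (?f w) / (1 - cmod w)\<^sup>2"
      by (rule cmod_deriv_div_one_minus_le[OF f w1])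
    also have "\<dots> \<le> (p * k / \<rho> ^ Suc k) / \<rho> + (p / \<rho> ^ k) / \<rho>\<^sup>2"
    proof (intro add_mono frac_le power_mono)
      have "cmod (deriv ?f w) \<le> p * k / u ^ Suc k"
        using cmod_deriv_bloch_test_le[OF d w1, of \<alpha> k] by (simp add: u_def p_def)
      also have "\<dots> \<le> p * k / \<rho> ^ Suc k"
        using u \<rho> p by (intro divide_left_mono power_mono mult_pos_pos zero_less_power) auto
      finally show "cmod (deriv ?f w) \<le> p * k / \<rho> ^ Suc k" .
      have "cmod (?f w) = p / u ^ k"
        using w1 by (simp add: bloch_test_def norm_divide norm_power u_def p_def)
      also have "\<dots> \<le> p / \<rho> ^ k"
        using u \<rho> p by (intro divide_left_mono power_mono mult_pos_pos zero_less_power) auto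
      finally show "cmod (?f w) \<le> p / \<rho> ^ k" .
    qed (use \<rho> \<rho>w p in auto)
    also have "\<dots> = p * ((real k + 1) / \<rho> ^ (k + 2))"
      using \<rho> by (simp add: field_simps power2_eq_square)
    finally show ?thesis by (simp add: w_def)
  qed
  have "cmod (deriv (cesaro_op \<mu> ?f) z) = cmod (\<integral>t. of_real t * deriv ?g (of_real t * z) \<partial>\<mu>)"
    using DERIV_imp_deriv[OF has_field_derivative_cesaro_op[OF f z]] by simp
  also have "\<dots> \<le> (\<integral>t. norm (of_real t * deriv ?g (of_real t * z)) \<partial>\<mu>)"
    by (rule integral_norm_bound)
  also have "\<dots> \<le> (\<integral>t. p * ((real k + 1) / \<rho> ^ (k + 2)) \<partial>\<mu>)"
    using pw p \<rho> by (intro integral_mono') auto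
  finally show ?thesis by (simp add: p_def \<rho>_def mult_ac)
qed

text \<open>At the real point 1 - d the integrand is nonnegative, so nothing cancels and the
  integral may be restricted to t \<ge> 1 - d, where every denominator is comparable to a power of
  d.\<close>

lemma measure_le_bloch_norm_cesaro_op_bloch_test:
  assumes d: "0 < d" "d \<le> 1 / 2" and T: "cesaro_op \<mu> (bloch_test \<alpha> k d) \<in> Bloch \<beta>" and \<beta>: "0 \<le> \<beta>"
  shows "measure \<mu> {1 - d..<1} \<le>
    2 * 3 ^ (k + 2) * bloch_norm \<beta> (cesaro_op \<mu> (bloch_test \<alpha> k d)) * d powr (\<alpha> + 1 - \<beta>)"
proof -
  let ?f = "bloch_test \<alpha> k d"
  let ?g = "\<lambda>w. ?f w / (1 - w)"
  define a where "a = 1 - d"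
  define p where "p = d powr (real k + 1 - \<alpha>)"
  have d1: "d < 1" and a: "1 / 2 \<le> a" "a < 1" "0 < a" and p: "0 < p" using d by (auto simp: a_def p_def)
  have f: "?f holomorphic_on ball 0 1"
    using bloch_test_in_hol_disc[OF d(1) d1] by (simp add: hol_disc_def)
  define G where "G t = t * (p * (k * a) / (1 - a * (t * a)) ^ Suc k / (1 - t * a) + p / (1 - a * (t * a)) ^ k / (1 - t * a)\<^sup>2)" for t
  have bds: "d \<le> 1 - t * a" "d \<le> 1 - a * (t * a)" if "0 \<le> t" "t \<le> 1" for t
  proof -
    have "t * a \<le> 1 * a" using that a by (intro mult_right_mono) auto
    moreover have "a * (t * a) \<le> t * a" using that a by (intro mult_left_le_one_le) auto
    ultimately show "d \<le> 1 - t * a" "d \<le> 1 - a * (t * a)" by (auto simp: a_def)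
  qed
  have gG: "of_real t * deriv ?g (of_real t * of_real a) = complex_of_real (G t)" if "t \<in> space \<mu>" for t
  proof -
    have t: "0 \<le> t" "t < 1" using that by (auto simp: space_radial)
    have w: "cmod (of_real (t * a)) < 1"
      using bds[of t] t a d unfolding norm_of_real by simp
    have "deriv ?f (of_real (t * a)) = of_real (p * (k * a) / (1 - a * (t * a)) ^ Suc k)"
      using DERIV_imp_deriv[OF has_field_derivative_bloch_test[OF d(1) d1 w, of \<alpha> k]] by (simp add: p_def a_def)
    moreover have "?f (of_real (t * a)) = of_real (p / (1 - a * (t * a)) ^ k)"
      using w by (simp add: bloch_test_def p_def a_def)
    ultimately show ?thesis
      using deriv_div_one_minus[OF f w] by (simp add: G_def)
  qed
  have G0: "0 \<le> G t" if "t \<in> space \<mu>" for t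
    using that bds[of t] d p a by (auto simp: G_def space_radial intro!: mult_nonneg_nonneg add_nonneg_nonneg)
  \<comment> \<open>A lower bound for \<open>G\<close> on [a, 1): the first summand is dropped, t
    \<ge> a \<ge> 1/2 gives the half, and both 1 - t a \<le> 1 - a^2 and 1 - a t a \<le> 1 - a^3 are
    at most 3 d.\<close>
  define c where "c = 1 / 2 * (p / (3 * d) ^ k / (3 * d)\<^sup>2)"
  have c0: "0 \<le> c" using p d by (simp add: c_def)
  have Gc: "c * indicator {a..<1} t \<le> G t" if t: "t \<in> space \<mu>" for t
  proof (cases "t \<in> {a..<1}")
    case True
    then have t1: "a \<le> t" "t < 1" "0 \<le> t" using a by auto
    have "a * a \<le> t * a" using t1 a by (intro mult_right_mono) auto
    then have "1 - t * a \<le> 1 - a * a" by simp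
    also have "\<dots> \<le> 3 * d" using d by (simp add: a_def algebra_simps)
    finally have l1: "1 - t * a \<le> 3 * d" .
    have "a * (a * a) \<le> a * (t * a)" using t1 a by (intro mult_left_mono mult_right_mono) auto
    moreover have "1 - a * (a * a) \<le> 3 * d"
    proof -
      have "1 - a * (a * a) = d * (1 + a + a * a)" by (simp add: a_def algebra_simps)
      also have "\<dots> \<le> d * 3" using a d mult_left_le[of a a] by (intro mult_left_mono) linarith+
      finally show ?thesis by simp
    qed
    ultimately have l2: "1 - a * (t * a) \<le> 3 * d" by simp
    note b = bds[of t]
    have "c \<le> t * (p / (1 - a * (t * a)) ^ k / (1 - t * a)\<^sup>2)"
      unfolding c_def using t1 a b l1 l2 d p
      by (intro mult_mono frac_le power_mono) auto
    also have "\<dots> \<le> G t"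
      unfolding G_def using t1 a b d p by (intro mult_left_mono) auto
    finally show ?thesis using True by simp
  next
    case False
    then show ?thesis using G0[OF t] by simp
  qed
  have intG: "integrable \<mu> G"
  proof (rule integrable_radial)
    show "continuous_on {0..<1} G"
      unfolding G_def using bds d by (intro continuous_intros) force+
    fix t :: real assume t: "0 \<le> t" "t < 1"
    have "G t \<le> 1 * (p * (k * 1) / d ^ Suc k / d + p / d ^ k / d\<^sup>2)"
      unfolding G_def using t a p bds[of t] d
      by (intro mult_mono add_mono frac_le power_mono) (auto intro!: add_nonneg_nonneg mult_left_le)
    moreover have "0 \<le> G t" using G0 t by (simp add: space_radial)
    ultimately show "norm (G t) \<le> 1 * (p * (k * 1) / d ^ Suc k / d + p / d ^ k / d\<^sup>2)"
      by simp
  qed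
  have a_sets: "{a..<1} \<in> sets \<mu>" using a by simp
  have "c * measure \<mu> {a..<1} = (\<integral>t. c * indicator {a..<1} t \<partial>\<mu>)"
    using sets.sets_into_space[OF a_sets] by (simp add: Int_absorb2)
  also have "\<dots> \<le> (\<integral>t. G t \<partial>\<mu>)"
    using intG Gc G0 by (intro integral_mono') auto
  also have "\<dots> \<le> cmod (of_real (\<integral>t. G t \<partial>\<mu>))"
    by simp
  also have "complex_of_real (\<integral>t. G t \<partial>\<mu>) = (\<integral>t. of_real t * deriv ?g (of_real t * of_real a) \<partial>\<mu>)"
    unfolding integral_complex_of_real[symmetric]
    by (rule Bochner_Integration.integral_cong) (use gG in auto)
  also have "\<dots> = deriv (cesaro_op \<mu> ?f) (of_real a)"
    using a by (intro DERIV_imp_deriv[OF has_field_derivative_cesaro_op[OF f], symmetric]) auto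
  finally have "c * measure \<mu> {a..<1} \<le> cmod (deriv (cesaro_op \<mu> ?f) (of_real a))" .
  moreover have "d powr \<beta> \<le> (1 - (cmod (of_real a))\<^sup>2) powr \<beta>"
  proof (rule powr_mono2[OF \<beta>])
    have "a * a \<le> a" using a by (simp add: mult_left_le)
    moreover have "d = 1 - a" by (simp add: a_def)
    ultimately show "d \<le> 1 - (cmod (of_real a))\<^sup>2" by (simp add: power2_eq_square)
  qed (use d in auto)
  ultimately have "d powr \<beta> * (c * measure \<mu> {a..<1}) \<le> bloch_weight \<beta> (cesaro_op \<mu> ?f) (of_real a)"
    unfolding bloch_weight_def using c0 by (intro mult_mono) auto
  also have "\<dots> \<le> bloch_norm \<beta> (cesaro_op \<mu> ?f)"
    using a by (intro bloch_weight_le_norm T) auto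
  finally have main: "d powr \<beta> * (c * measure \<mu> {a..<1}) \<le> bloch_norm \<beta> (cesaro_op \<mu> ?f)" .
  have dk: "d ^ k * d\<^sup>2 = d powr (k + 2)"
    using d powr_realpow[of d "k + 2"] by (simp add: power_add power2_eq_square)
  \<comment> \<open>The exponents add up as (k + 1 - \<alpha>) - (k + 2), so the dependence on k
    disappears up to a constant.\<close>
  have "p / (d ^ k * d\<^sup>2) = d powr - (\<alpha> + 1)"
    unfolding p_def dk powr_diff[symmetric] by (rule arg_cong[where f = "(powr) d"]) simp
  then have "c = d powr - (\<alpha> + 1) / (2 * 3 ^ (k + 2))"
    by (simp add: c_def power_mult_distrib power_add field_simps)
  moreover have "d powr \<beta> * d powr - (\<alpha> + 1) = d powr - (\<alpha> + 1 - \<beta>)"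
    unfolding powr_add[symmetric] by (rule arg_cong[where f = "(powr) d"]) simp
  ultimately have "d powr \<beta> * c = d powr - (\<alpha> + 1 - \<beta>) / (2 * 3 ^ (k + 2))"
    by (simp only: times_divide_eq_right)
  then have "d powr - (\<alpha> + 1 - \<beta>) / (2 * 3 ^ (k + 2)) * measure \<mu> {a..<1} \<le> bloch_norm \<beta> (cesaro_op \<mu> ?f)"
    using main by (simp only: mult.assoc[symmetric])
  then show ?thesis
    using d by (simp only: powr_minus) (simp add: a_def field_simps)
qed

text \<open>If the condition fails along some d_n \<rightarrow> 0, the lower bound keeps the image
  norms away from 0. Compactness yields a norm-convergent subsequence, whose limit has zero
  derivative, and this forces the norms to 0 after all.\<close>

lemma vanishing_carleson_if_compact:
  assumes \<alpha>: "0 < \<alpha>" and \<beta>: "0 < \<beta>" and comp: "compact_Bloch_operator \<alpha> \<beta> (cesaro_op \<mu>)"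
  shows "vanishing_carleson (\<alpha> + 1 - \<beta>) (disc_measure \<mu>)"
proof (rule ccontr)
  assume "\<not> vanishing_carleson (\<alpha> + 1 - \<beta>) (disc_measure \<mu>)"
  then obtain \<epsilon> where \<epsilon>: "0 < \<epsilon>"
    and ex: "\<And>x0. 0 < x0 \<Longrightarrow> x0 \<le> 1 \<Longrightarrow> \<exists>x. 0 < x \<and> x \<le> x0 \<and> \<epsilon> * x powr (\<alpha> + 1 - \<beta>) < measure \<mu> {1 - x..<1}"
    unfolding vanishing_carleson_disc_measure_iff by (meson not_le)
  \<comment> \<open>The shift by 2 gives d_n \<le> 1/2 from n = 0 on, as the lower bound
    requires.\<close>
  have "\<forall>n::nat. \<exists>x. 0 < x \<and> x \<le> 1 / (real n + 2) \<and> \<epsilon> * x powr (\<alpha> + 1 - \<beta>) < measure \<mu> {1 - x..<1}"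
    by (intro allI ex) auto
  then obtain d where d: "\<And>n::nat. 0 < d n" "\<And>n. d n \<le> 1 / (real n + 2)"
    and dm: "\<And>n. \<epsilon> * d n powr (\<alpha> + 1 - \<beta>) < measure \<mu> {1 - d n..<1}"
    by metis
  have d2: "d n \<le> 1 / 2" for n
    using d(2)[of n] by (rule order_trans) (simp add: field_simps)
  then have d1: "d n < 1" for n using order.strict_trans1[OF d2] by simp
  have d_lim: "d \<longlonglongrightarrow> 0"
  proof (rule tendsto_sandwich[OF _ _ tendsto_const])
    show "(\<lambda>n. 1 / (real n + 2)) \<longlonglongrightarrow> 0" by real_asymp
  qed (use d less_imp_le[OF d(1)] in auto)
  obtain k :: nat where k: "\<alpha> \<le> k" using real_arch_simple by blast
  have dp_lim: "(\<lambda>n. d n powr (real k + 1 - \<alpha>)) \<longlonglongrightarrow> 0"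
    using k less_imp_le[OF d(1)] by (intro tendsto_zero_powrI[OF d_lim tendsto_const]) auto
  define f where "f n = bloch_test \<alpha> k (d n)" for n
  define \<sigma> where "\<sigma> n = cesaro_op \<mu> (f n)" for n
  have f: "f n \<in> Bloch \<alpha>" "bloch_norm \<alpha> (f n) \<le> 1 + 2 powr \<alpha> * k" for n
    using bloch_test_Bloch[OF \<alpha> k d(1) d1] by (auto simp: f_def)
  have \<sigma>: "\<sigma> n \<in> Bloch \<beta>" for n
    using comp f by (auto simp: compact_Bloch_operator_def \<sigma>_def)
  have "range f \<subseteq> Bloch \<alpha> \<and> (\<forall>g\<in>range f. bloch_norm \<alpha> g \<le> 1 + 2 powr \<alpha> * k)"
    using f by auto
  then have "compactin (Bloch_topology \<beta>) (Bloch_topology \<beta> closure_of (cesaro_op \<mu> ` range f))"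
    using comp unfolding compact_Bloch_operator_def by blast
  moreover have "cesaro_op \<mu> ` range f = range \<sigma>" by (auto simp: \<sigma>_def)
  moreover have "range \<sigma> \<subseteq> Bloch \<beta>" using \<sigma> by blast
  ultimately have "\<forall>\<tau>::nat \<Rightarrow> complex \<Rightarrow> complex. range \<tau> \<subseteq> range \<sigma> \<longrightarrow>
      (\<exists>l r. l \<in> Bloch \<beta> \<and> strict_mono r \<and> (\<lambda>n. bloch_norm \<beta> (\<lambda>z. \<tau> (r n) z - l z)) \<longlonglongrightarrow> 0)"
    by (simp only: compactin_closure_Bloch_iff)
  from this[rule_format, OF subset_refl]
  obtain l r where l: "l \<in> Bloch \<beta>" and r: "strict_mono (r :: nat \<Rightarrow> nat)"
    and lim: "(\<lambda>n. bloch_norm \<beta> (\<lambda>z. \<sigma> (r n) z - l z)) \<longlonglongrightarrow> 0"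
    by blast
  have diff: "deriv (\<lambda>z. \<sigma> (r n) z - l z) z = deriv (\<sigma> (r n)) z - deriv l z" if "cmod z < 1" for n z
    using that \<sigma>[of "r n"] l by (intro deriv_diff hol_disc_differentiable) (auto simp: Bloch_def)
  \<comment> \<open>Norm convergence makes the derivatives at z tend to l'(z), while the pointwise
    bound makes them tend to 0.\<close>
  have dl: "deriv l z = 0" if z: "cmod z < 1" for z
  proof -
    let ?W = "(1 - (cmod z)\<^sup>2) powr \<beta>"
    have "(\<lambda>n. d n powr (real k + 1 - \<alpha>) * ((real k + 1) / (1 - cmod z) ^ (k + 2) * measure \<mu> (space \<mu>))) \<longlonglongrightarrow> 0"
      using tendsto_mult_left_zero[OF dp_lim] .
    then have "(\<lambda>n. deriv (\<sigma> n) z) \<longlonglongrightarrow> 0"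
      by (rule Lim_null_comparison[rotated])
        (use cmod_deriv_cesaro_op_bloch_test_le[OF d(1) d1 z] in \<open>auto simp: \<sigma>_def f_def\<close>)
    then have "(\<lambda>n. deriv (\<sigma> (r n)) z) \<longlonglongrightarrow> 0"
      using LIMSEQ_subseq_LIMSEQ[OF _ r] by (fastforce simp: o_def)
    then have 1: "(\<lambda>n. ?W * cmod (deriv (\<sigma> (r n)) z - deriv l z)) \<longlonglongrightarrow> ?W * cmod (0 - deriv l z)"
      by (intro tendsto_intros)
    have "bloch_weight \<beta> (\<lambda>z. \<sigma> (r n) z - l z) z \<le> bloch_norm \<beta> (\<lambda>z. \<sigma> (r n) z - l z)" for n
      by (intro bloch_weight_le_norm Bloch_diff \<sigma> l z)
    then have "(\<lambda>n. bloch_weight \<beta> (\<lambda>z. \<sigma> (r n) z - l z) z) \<longlonglongrightarrow> 0"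
      by (intro Lim_null_comparison[OF _ lim]) (auto simp: bloch_weight_nonneg)
    then have "(\<lambda>n. ?W * cmod (deriv (\<sigma> (r n)) z - deriv l z)) \<longlonglongrightarrow> 0"
      by (simp add: bloch_weight_def diff[OF z])
    with 1 have "?W * cmod (0 - deriv l z) = 0" by (rule LIMSEQ_unique)
    moreover have "(cmod z)\<^sup>2 < 1" using z by (simp add: abs_square_less_1)
    ultimately show ?thesis by simp
  qed
  define c where "c = \<epsilon> / (2 * 3 ^ (k + 2))"
  have c: "0 < c" using \<epsilon> by (simp add: c_def)
  have lower: "c \<le> bloch_norm \<beta> (\<sigma> n)" for n
  proof -
    have "\<epsilon> * d n powr (\<alpha> + 1 - \<beta>) \<le> 2 * 3 ^ (k + 2) * bloch_norm \<beta> (\<sigma> n) * d n powr (\<alpha> + 1 - \<beta>)"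
      using dm[of n] measure_le_bloch_norm_cesaro_op_bloch_test[OF d(1)[of n] d2[of n], where \<alpha> = \<alpha> and k = k and \<beta> = \<beta>] \<sigma>[of n] \<beta>
      by (simp add: \<sigma>_def f_def)
    then have "\<epsilon> \<le> 2 * 3 ^ (k + 2) * bloch_norm \<beta> (\<sigma> n)"
      using d(1)[of n] by (simp only: mult_le_cancel_right_pos powr_gt_zero)
    then show ?thesis by (simp add: c_def field_simps)
  qed
  \<comment> \<open>Since l' = 0, the weights of \<sigma> and of \<sigma> - l agree. The derivative
    says nothing about l(0), so the value of \<sigma> at 0 is computed directly as the first
    summand.\<close>
  define u where "u n = measure \<mu> (space \<mu>) * d (r n) powr (real k + 1 - \<alpha>) + bloch_norm \<beta> (\<lambda>z. \<sigma> (r n) z - l z)" for n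
  have upper: "bloch_norm \<beta> (\<sigma> (r n)) \<le> u n" for n
  proof -
    have "bloch_weight \<beta> (\<sigma> (r n)) z \<le> bloch_norm \<beta> (\<lambda>z. \<sigma> (r n) z - l z)" if z: "cmod z < 1" for z
      using bloch_weight_le_norm[OF Bloch_diff[OF \<sigma>[of "r n"] l] z]
      by (simp add: bloch_weight_def diff[OF z] dl[OF z])
    then have "bloch_norm \<beta> (\<sigma> (r n)) \<le> cmod (\<sigma> (r n) 0) + bloch_norm \<beta> (\<lambda>z. \<sigma> (r n) z - l z)"
      by (rule bloch_norm_le)
    also have "cmod (\<sigma> (r n) 0) = measure \<mu> (space \<mu>) * d (r n) powr (real k + 1 - \<alpha>)"
      by (simp add: \<sigma>_def cesaro_op_at_0 norm_mult f_def bloch_test_def)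
    finally show ?thesis by (simp add: u_def)
  qed
  have "(\<lambda>n. d (r n) powr (real k + 1 - \<alpha>)) \<longlonglongrightarrow> 0"
    using LIMSEQ_subseq_LIMSEQ[OF dp_lim r] by (simp add: o_def)
  then have "u \<longlonglongrightarrow> 0"
    unfolding u_def using tendsto_add[OF tendsto_mult_right_zero lim] by fastforce
  then have "c \<le> 0"
    using order_trans[OF lower upper] by (intro LIMSEQ_le_const) auto
  then show False using c by simp
qed

end

theorem theorem4p1:
  fixes \<mu> :: "real measure" and \<alpha> \<beta> :: real
  assumes "finite_measure \<mu>"
    and "sets \<mu> = sets (restrict_space borel {0..<1})"
    and "\<alpha> > 1" and "0 < \<beta>" and "\<beta> < \<alpha> + 1"
  shows "compact_Bloch_operator \<alpha> \<beta> (cesaro_op \<mu>) \<longleftrightarrow>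
    vanishing_carleson (\<alpha> + 1 - \<beta>) (disc_measure \<mu>)"
proof -
  interpret radial_measure \<mu>
    using assms by (simp add: radial_measure_def radial_measure_axioms_def)
  show ?thesis
    using vanishing_carleson_if_compact compact_cesaro_op assms by auto
qed

end
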